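(* Let $\alpha>0$ and, for $\beta>-1$, let $F^2_{\alpha,\beta}$ be the space of entire functions $f$ with $$\int_{\mathbb C}|f(z)|^2|z|^{2\beta}e^{-\alpha|z|^2}\,dA(z)<\infty.$$ The equation $\Gamma(\kappa)=(\kappa/e)^\kappa$ has a unique positive solution $\kappa_1$. If $-1<\beta\le\kappa_1-1=5.4475\ldots$, then the Korenblum radius of $F^2_{\alpha,\beta}$ equals $\sqrt{(\beta+1)/\alpha}$, and this radius is admissible. Moreover $\kappa_1>2\pi$, so this includes all $\beta$ with $-1<\beta\le2\pi-1$.
   Context: $dA$ is area measure on $\mathbb C$, and $\Gamma$ is the Gamma function. The space $F^2_{\alpha,\beta}$ carries the norm $\|f\|=\bigl(\int_{\mathbb C}|f(z)|^2|z|^{2\beta}e^{-\alpha|z|^2}\,dA(z)\bigr)^{1/2}$ (a constant factor in the norm is immaterial). A radius $R>0$ is admissible for this space if $\|f\|\le\|g\|$ for all $f,g$ in the space with $|f(z)|\le|g(z)|$ for $|z|>R$. The Korenblum radius of the space is the supremum of the admissible radii. *)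

theory Defs
  imports "HOL-Analysis.Analysis"
begin

(* For z = 0 Isabelle has 0 powr (2 * b) = 0 for every b; this changes the
   weight only on a Lebesgue null set. *)
definition fock_weight :: "real \<Rightarrow> real \<Rightarrow> complex \<Rightarrow> real" where
  "fock_weight \<alpha> \<beta> z = norm z powr (2 * \<beta>) * exp (- \<alpha> * (norm z)\<^sup>2)"

definition fock_space :: "real \<Rightarrow> real \<Rightarrow> (complex \<Rightarrow> complex) set" where
  "fock_space \<alpha> \<beta> =
     {f. f holomorphic_on UNIV \<and> integrable lborel (\<lambda>z. (norm (f z))\<^sup>2 * fock_weight \<alpha> \<beta> z)}"

definition fock_norm :: "real \<Rightarrow> real \<Rightarrow> (complex \<Rightarrow> complex) \<Rightarrow> real" where
  "fock_norm \<alpha> \<beta> f = sqrt (\<integral>z. (norm (f z))\<^sup>2 * fock_weight \<alpha> \<beta> z \<partial>lborel)"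

definition admissible :: "real \<Rightarrow> real \<Rightarrow> real \<Rightarrow> bool" where
  "admissible \<alpha> \<beta> R \<longleftrightarrow> R > 0 \<and>
     (\<forall>f\<in>fock_space \<alpha> \<beta>. \<forall>g\<in>fock_space \<alpha> \<beta>.
        (\<forall>z. norm z > R \<longrightarrow> norm (f z) \<le> norm (g z)) \<longrightarrow>
        fock_norm \<alpha> \<beta> f \<le> fock_norm \<alpha> \<beta> g)"

(* Taken in the extended reals, where a supremum always exists: an equation
   with a finite value thus includes the boundedness of the admissible radii. *)
definition korenblum_radius :: "real \<Rightarrow> real \<Rightarrow> ereal" where
  "korenblum_radius \<alpha> \<beta> = (SUP R\<in>{R. admissible \<alpha> \<beta> R}. ereal R)"

definition kappa_eq :: "real \<Rightarrow> bool" where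
  "kappa_eq \<kappa> \<longleftrightarrow> Gamma \<kappa> = (\<kappa> / exp 1) powr \<kappa>"

(* Meaningful only together with the unique existence of a positive solution. *)
definition kappa1 :: real where
  "kappa1 = (THE \<kappa>. \<kappa> > 0 \<and> kappa_eq \<kappa>)"

end

theory Submission
  imports Defs "HOL-Complex_Analysis.Complex_Analysis" "HOL-Real_Asymp.Real_Asymp"
begin

text \<open>
  Write \<open>\<kappa> = \<beta> + 1\<close> and \<open>R\<^sup>2 = \<kappa>/\<alpha>\<close>. If \<open>|f| \<le> |g|\<close> for \<open>|z| > R\<close>, then \<open>f = h g\<close> there, where
  \<open>h\<close> is holomorphic near infinity as well and bounded by 1. Expanding \<open>h\<close> in powers of \<open>1/z\<close>,
  the coefficients of \<open>f\<close> of index at least \<open>N\<close> depend only on those of \<open>g\<close> of index at least \<open>N\<close>,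
  and multiplication by \<open>h\<close> is a contraction on every circle outside the disc; letting the radius
  tend to \<open>R\<close>, every tail of \<open>\<Sum> |f\<^sub>n|\<^sup>2 R\<^sup>2\<^sup>n\<close> is at most the corresponding tail for \<open>g\<close>. On the
  other hand \<open>\<parallel>f\<parallel>\<^sup>2\<close> is a constant times \<open>\<Sum> c\<^sub>n |f\<^sub>n|\<^sup>2 R\<^sup>2\<^sup>n\<close> with \<open>c\<^sub>n = \<Gamma>(n + \<kappa>) / \<kappa>\<^sup>n\<close>, and
  \<open>c\<^sub>n\<close> is nondecreasing because \<open>c\<^sub>n\<^sub>+\<^sub>1 / c\<^sub>n = (n + \<kappa>) / \<kappa>\<close>; so summation by parts gives
  \<open>\<parallel>f\<parallel> \<le> \<parallel>g\<parallel>\<close>. The pair \<open>f = R\<close>, \<open>g = z\<close> shows that no larger radius is admissible.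

  The function \<open>ln \<Gamma>(\<kappa>) - \<kappa> ln \<kappa> + \<kappa>\<close> is strictly decreasing because the digamma function is
  smaller than the logarithm; its zero is located by Stirling's formula with explicit error bounds.
\<close>

section \<open>Stirling bounds and the number \<open>\<kappa>\<^sub>1\<close>\<close>

text \<open>The error term of Stirling's formula for the log-Gamma function; the constant
  \<open>ln (2 * pi) / 2\<close> is the one for which it tends to 0 at infinity.\<close>

definition stirling_rem :: "real \<Rightarrow> real" where
  "stirling_rem x = ln_Gamma x - (x - 1/2) * ln x + x - ln (2 * pi) / 2"

lemma ln_Gamma_real_plus1: "x > 0 \<Longrightarrow> ln_Gamma (x + 1) = ln_Gamma x + ln (x :: real)"
proof -
  assume x: "x > 0"
  then have "x \<notin> \<int>\<^sub>\<le>\<^sub>0" by (auto elim!: nonpos_Ints_cases')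
  with x show ?thesis
    using ln_mult_pos[OF x Gamma_real_pos[OF x]] by (simp add: ln_Gamma_real_pos Gamma_plus1)
qed

text \<open>Over a unit step the Gamma function cancels and an elementary expression remains, so
  bounds on that expression telescope to bounds on the remainder.\<close>

lemma stirling_rem_plus1:
  assumes "x > 0"
  shows "stirling_rem x - stirling_rem (x + 1) = (x + 1/2) * ln (1 + 1 / x) - 1"
proof -
  have "ln (1 + 1 / x) = ln (x + 1) - ln x"
    using assms by (simp add: ln_divide_pos [symmetric] add_divide_distrib)
  then show ?thesis
    using assms unfolding stirling_rem_def ln_Gamma_real_plus1[OF assms]
    by (simp only:) (simp add: field_simps)
qed

text \<open>\<open>F'\<close> is nondecreasing with limit 0, hence nonpositive; so \<open>F\<close>
  is nonincreasing with limit 0, hence nonnegative.\<close>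

lemma convex_vanishing_at_top_nonneg:
  fixes F F' F'' :: "real \<Rightarrow> real"
  assumes F: "\<And>x. x > 0 \<Longrightarrow> (F has_real_derivative F' x) (at x)"
    and F': "\<And>x. x > 0 \<Longrightarrow> (F' has_real_derivative F'' x) (at x)"
    and pos: "\<And>x. x > 0 \<Longrightarrow> F'' x \<ge> 0"
    and lim: "(F \<longlongrightarrow> 0) at_top" "(F' \<longlongrightarrow> 0) at_top"
    and x: "x > 0"
  shows "F x \<ge> 0"
proof -
  have F'_le: "F' y \<le> 0" if "y > 0" for y
  proof (rule tendsto_lowerbound[OF lim(2)])
    show "\<forall>\<^sub>F z in at_top. F' y \<le> F' z"
      using eventually_ge_at_top[of y]
    proof eventually_elim
      case (elim z)
      show ?case
        using that elim by (intro DERIV_nonneg_imp_nondecreasing[OF elim]) (meson F' pos less_le_trans)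
    qed
  qed auto
  show ?thesis
  proof (rule tendsto_upperbound[OF lim(1)])
    show "\<forall>\<^sub>F z in at_top. F z \<le> F x"
      using eventually_ge_at_top[of x]
    proof eventually_elim
      case (elim z)
      show ?case
        using x elim by (intro DERIV_nonpos_imp_nonincreasing[OF elim]) (meson F F'_le less_le_trans)
    qed
  qed auto
qed

text \<open>The asymptotic series of the remainder, with Bernoulli-number coefficients B_2k / (2k
  (2k - 1)), cut after two terms; \<open>stirling_hi\<close> keeps three.\<close>

definition stirling_lo :: "real \<Rightarrow> real" where
  "stirling_lo x = 1 / (12 * x) - 1 / (360 * x^3)"

definition stirling_hi :: "real \<Rightarrow> real" where
  "stirling_hi x = 1 / (12 * x) - 1 / (360 * x^3) + 1 / (1260 * x^5)"

text \<open>The difference of the two sides and its derivative vanish at infinity, and two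
  differentiations remove the logarithm, so the claim reduces to the sign of a rational
  function.\<close>

lemma stirling_step_lo:
  assumes "x > 0"
  shows "stirling_lo x - stirling_lo (x + 1) \<le> (x + 1/2) * ln (1 + 1 / x) - 1"
proof -
  define F where "F = (\<lambda>x::real. (x + 1/2) * ln (1 + 1 / x) - 1
    - (1 / (12 * x) - 1 / (360 * x^3)) + (1 / (12 * (x+1)) - 1 / (360 * (x+1)^3)))"
  define F' where "F' = (\<lambda>x::real. ln (1 + 1 / x) - (1 / x + 1 / (x + 1)) / 2
    + (1 / (12 * x^2) - 1 / (120 * x^4)) - (1 / (12 * (x+1)^2) - 1 / (120 * (x+1)^4)))"
  \<comment> \<open>The derivative of \<open>F'\<close> over a common denominator; all coefficients
    of the numerator are positive.\<close>
  define F'' where "F'' = (\<lambda>x::real. (1 + 5*x + 5*x^2) / (30 * x^5 * (x+1)^5))"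
  have "F x \<ge> 0"
  proof (rule convex_vanishing_at_top_nonneg[of F F' F''])
    fix x :: real assume x: "x > 0"
    have nz: "1 + 1 / x > 0" "x + 1 \<noteq> 0" "1 + 1 / x = (x + 1) / x" "x \<noteq> 0"
      using x by (auto intro: add_pos_pos simp: field_simps)
    show "(F has_real_derivative F' x) (at x)"
      unfolding F_def F'_def using x nz
      by (auto intro!: derivative_eq_intros) (simp add: divide_simps, algebra)
    show "(F' has_real_derivative F'' x) (at x)"
      unfolding F'_def F''_def using x nz
      by (auto intro!: derivative_eq_intros) (simp add: divide_simps, algebra)
    show "F'' x \<ge> 0"
      using x by (simp add: F''_def)
  next
    show "(F \<longlongrightarrow> 0) at_top" unfolding F_def by real_asymp
    show "(F' \<longlongrightarrow> 0) at_top" unfolding F'_def by real_asymp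
  qed fact
  then show ?thesis
    by (simp add: F_def stirling_lo_def)
qed

text \<open>The same convexity argument with the opposite sign; with the third term included, the
  numerator of the second derivative again has only positive coefficients.\<close>

lemma stirling_step_hi:
  assumes "x > 0"
  shows "(x + 1/2) * ln (1 + 1 / x) - 1 \<le> stirling_hi x - stirling_hi (x + 1)"
proof -
  define F where "F = (\<lambda>x::real. 1 - (x + 1/2) * ln (1 + 1 / x)
    + (1 / (12 * x) - 1 / (360 * x^3) + 1 / (1260 * x^5))
    - (1 / (12 * (x+1)) - 1 / (360 * (x+1)^3) + 1 / (1260 * (x+1)^5)))"
  define F' where "F' = (\<lambda>x::real. (1 / x + 1 / (x + 1)) / 2 - ln (1 + 1 / x)
    - (1 / (12 * x^2) - 1 / (120 * x^4) + 1 / (252 * x^6))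
    + (1 / (12 * (x+1)^2) - 1 / (120 * (x+1)^4) + 1 / (252 * (x+1)^6)))"
  define F'' where "F'' = (\<lambda>x::real. (5 + 35*x + 98*x^2 + 126*x^3 + 63*x^4) / (210 * x^7 * (x+1)^7))"
  have "F x \<ge> 0"
  proof (rule convex_vanishing_at_top_nonneg[of F F' F''])
    fix x :: real assume x: "x > 0"
    have nz: "1 + 1 / x > 0" "x + 1 \<noteq> 0" "1 + 1 / x = (x + 1) / x" "x \<noteq> 0"
      using x by (auto intro: add_pos_pos simp: field_simps)
    show "(F has_real_derivative F' x) (at x)"
      unfolding F_def F'_def using x nz
      by (auto intro!: derivative_eq_intros) (simp add: divide_simps, algebra)
    show "(F' has_real_derivative F'' x) (at x)"
      unfolding F'_def F''_def using x nz
      by (auto intro!: derivative_eq_intros) (simp add: divide_simps, algebra)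
    show "F'' x \<ge> 0"
      using x by (simp add: F''_def)
  next
    show "(F \<longlongrightarrow> 0) at_top" unfolding F_def by real_asymp
    show "(F' \<longlongrightarrow> 0) at_top" unfolding F'_def by real_asymp
  qed fact
  then show ?thesis
    by (simp add: F_def stirling_hi_def)
qed

text \<open>Euler's limit formula compares \<Gamma>(x + n + 1) with n! n^x; the elementary terms
  left over cancel asymptotically. Hence the limit of the remainder is the same along every sequence
  x + n.\<close>

lemma stirling_rem_shift_LIMSEQ:
  assumes x: "x > 0"
  shows "(\<lambda>n. stirling_rem (x + real n + 1) - stirling_rem (real n + 1)) \<longlonglongrightarrow> 0"
proof -
  have nonpos: "x \<notin> \<int>\<^sub>\<le>\<^sub>0" using x by (auto elim!: nonpos_Ints_cases')
  \<comment> \<open>The left side is the logarithm of Euler's product, up to the additive constant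
    \<open>ln_Gamma x\<close>.\<close>
  have G: "ln_Gamma (real n + 1) + x * ln (real n) - ln_Gamma (x + real n + 1)
      = ln (Gamma_series x n) - ln_Gamma x" for n
  proof -
    have "Gamma (x + real (n + 1)) = pochhammer x (n + 1) * Gamma x"
      using pochhammer_Gamma[OF nonpos, of "n + 1"] x by (simp add: Gamma_eq_zero_iff nonpos)
    then have "ln_Gamma (x + real n + 1) = ln (pochhammer x (n + 1)) + ln_Gamma x"
      using x ln_mult_pos[OF pochhammer_pos[OF x, of "n + 1"] Gamma_real_pos[OF x]]
      by (simp add: ln_Gamma_real_pos add_ac)
    moreover have "ln_Gamma (real n + 1) = ln (fact n)"
      using ln_Gamma_real_conv_fact[of "n + 1"] by (simp add: add.commute)
    ultimately show ?thesis
      using x by (simp add: Gamma_series_def ln_mult_pos ln_divide_pos pochhammer_pos del: pochhammer_Suc)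
  qed
  have "(\<lambda>n. ln (Gamma_series x n) - ln_Gamma x) \<longlonglongrightarrow> ln (Gamma x) - ln_Gamma x"
    using x Gamma_real_pos[OF x] by (intro tendsto_intros) (auto simp: less_imp_neq [symmetric])
  then have "(\<lambda>n. ln_Gamma (real n + 1) + x * ln (real n) - ln_Gamma (x + real n + 1)) \<longlonglongrightarrow> 0"
    using x unfolding G by (simp add: ln_Gamma_real_pos)
  moreover have "(\<lambda>n. x * ln (real n) - (x + real n + 1/2) * ln (x + real n + 1)
      + (real n + 1/2) * ln (real n + 1) + x) \<longlonglongrightarrow> 0"
    by real_asymp
  ultimately have "(\<lambda>n. (x * ln (real n) - (x + real n + 1/2) * ln (x + real n + 1)
      + (real n + 1/2) * ln (real n + 1) + x)
      - (ln_Gamma (real n + 1) + x * ln (real n) - ln_Gamma (x + real n + 1))) \<longlonglongrightarrow> 0 - 0"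
    by (intro tendsto_diff)
  then show ?thesis
    by (simp add: stirling_rem_def algebra_simps)
qed

section \<open>The constant in Stirling's formula, from the duplication formula\<close>

lemma Gamma_legendre_duplication_real:
  assumes "x > 0"
  shows "Gamma x * Gamma (x + 1/2) = exp ((1 - 2 * x) * ln 2) * sqrt pi * Gamma (2 * x :: real)"
proof -
  have "complex_of_real x \<notin> \<int>\<^sub>\<le>\<^sub>0" "complex_of_real x + 1/2 \<notin> \<int>\<^sub>\<le>\<^sub>0"
    using assms by (auto elim!: nonpos_Ints_cases' simp: complex_eq_iff)
  from Gamma_legendre_duplication[OF this]
  have "complex_of_real (Gamma x * Gamma (x + 1/2)) =
      of_real (exp ((1 - 2 * x) * ln 2) * sqrt pi * Gamma (2 * x))"
    using Gamma_complex_of_real[of x] Gamma_complex_of_real[of "x + 1/2"]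
      Gamma_complex_of_real[of "2 * x"]
    by (simp add: exp_of_real [symmetric])
  then show ?thesis
    using of_real_eq_iff by blast
qed

text \<open>The logarithm of the duplication formula. The three remainders will have a common limit
  \<open>L\<close>, and the right side tends to 0, which forces \<open>L = 0\<close>.\<close>

lemma stirling_rem_duplication:
  assumes x: "x > 0"
  shows "stirling_rem x + stirling_rem (x + 1/2) - stirling_rem (2 * x)
    = 1/2 - x * ln (1 + 1 / (2 * x))"
proof -
  have "ln (Gamma x * Gamma (x + 1/2)) = ln (exp ((1 - 2 * x) * ln 2) * sqrt pi * Gamma (2 * x))"
    using Gamma_legendre_duplication_real[OF x] by simp
  then have "ln_Gamma x = (1 - 2 * x) * ln 2 + ln pi / 2 + ln_Gamma (2 * x) - ln_Gamma (x + 1/2)"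
    using x by (simp add: ln_Gamma_real_pos ln_mult_pos ln_sqrt)
  moreover have "ln (1 + 1 / (2 * x)) = ln (x + 1/2) - ln x"
    using x by (simp add: ln_divide_pos [symmetric] add_divide_distrib)
  moreover have "ln (2 * x) = ln 2 + ln x" "ln (2 * pi) = ln 2 + ln pi"
    using x by (auto simp: ln_mult_pos)
  ultimately show ?thesis
    unfolding stirling_rem_def by (simp only:) (simp add: field_simps)
qed

text \<open>The one-step bound makes the excess over \<open>stirling_lo\<close> decrease; once its
  limit is known to be 0, its first term must be nonnegative. \<open>incseq_stirling_hi\<close> is
  the mirror image.\<close>

lemma decseq_stirling_lo: 
  assumes "x > 0"
  shows "decseq (\<lambda>n. stirling_rem (x + real n) - stirling_lo (x + real n))"
  unfolding decseq_Suc_iff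
proof
  fix n
  show "stirling_rem (x + real (Suc n)) - stirling_lo (x + real (Suc n))
      \<le> stirling_rem (x + real n) - stirling_lo (x + real n)"
    using stirling_step_lo[of "x + real n"] stirling_rem_plus1[of "x + real n"] assms
    by (simp add: add_ac)
qed

lemma incseq_stirling_hi: 
  assumes "x > 0"
  shows "incseq (\<lambda>n. stirling_rem (x + real n) - stirling_hi (x + real n))"
  unfolding incseq_Suc_iff
proof
  fix n
  show "stirling_rem (x + real n) - stirling_hi (x + real n)
      \<le> stirling_rem (x + real (Suc n)) - stirling_hi (x + real (Suc n))"
    using stirling_step_hi[of "x + real n"] stirling_rem_plus1[of "x + real n"] assms
    by (simp add: add_ac)
qed

text \<open>Convergence comes from monotonicity; the limit is then identified by the duplication
  identity along n + 1, n + 3/2 and 2(n + 1).\<close>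

lemma stirling_rem_nat_LIMSEQ: "(\<lambda>n. stirling_rem (real n + 1)) \<longlonglongrightarrow> 0"
proof -
  let ?a = "\<lambda>n. stirling_rem (1 + real n) - stirling_lo (1 + real n)"
  \<comment> \<open>The decreasing sequence lies above the increasing one, hence above the first
    term of the latter.\<close>
  have "stirling_rem 1 - stirling_hi 1 \<le> ?a n" for n
  proof -
    have "stirling_lo (1 + real n) \<le> stirling_hi (1 + real n)"
      by (simp add: stirling_lo_def stirling_hi_def)
    then show ?thesis
      using incseqD[OF incseq_stirling_hi[of 1], of 0 n] by simp
  qed
  then obtain L where "?a \<longlonglongrightarrow> L"
    using decseq_convergent[OF decseq_stirling_lo[of 1]] by (metis zero_less_one)
  moreover have "(\<lambda>n. stirling_lo (1 + real n)) \<longlonglongrightarrow> 0"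
    unfolding stirling_lo_def by real_asymp
  ultimately have "(\<lambda>n. ?a n + stirling_lo (1 + real n)) \<longlonglongrightarrow> L + 0"
    by (rule tendsto_add)
  then have L: "(\<lambda>n. stirling_rem (real n + 1)) \<longlonglongrightarrow> L"
    by (simp add: add.commute)
  have "(\<lambda>n. (stirling_rem (1/2 + real n + 1) - stirling_rem (real n + 1)) + stirling_rem (real n + 1))
      \<longlonglongrightarrow> 0 + L"
    by (intro tendsto_add stirling_rem_shift_LIMSEQ L) simp
  then have half: "(\<lambda>n. stirling_rem (real n + 1 + 1/2)) \<longlonglongrightarrow> L"
    by (simp add: add_ac)
  \<comment> \<open>The index 2n + 1 corresponds to the argument (2n + 1) + 1 = 2(n + 1).\<close>
  have "filterlim (\<lambda>n::nat. 2 * n + 1) at_top at_top"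
    by real_asymp
  from filterlim_compose[OF L this]
  have twice: "(\<lambda>n. stirling_rem (2 * (real n + 1))) \<longlonglongrightarrow> L"
    by (simp add: algebra_simps)
  have "(\<lambda>n. stirling_rem (real n + 1) + stirling_rem (real n + 1 + 1/2) - stirling_rem (2 * (real n + 1)))
      \<longlonglongrightarrow> L + L - L"
    by (intro tendsto_intros L half twice)
  then have "(\<lambda>n. 1/2 - (real n + 1) * ln (1 + 1 / (2 * (real n + 1)))) \<longlonglongrightarrow> L"
    by (subst (asm) stirling_rem_duplication) auto
  moreover have "(\<lambda>n. 1/2 - (real n + 1) * ln (1 + 1 / (2 * (real n + 1)))) \<longlonglongrightarrow> 0"
    by real_asymp
  ultimately have "L = 0"
    by (rule LIMSEQ_unique)
  with L show ?thesis by simp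
qed

lemma stirling_rem_LIMSEQ:
  assumes x: "x > 0"
  shows "(\<lambda>n. stirling_rem (x + real n)) \<longlonglongrightarrow> 0"
proof -
  have "(\<lambda>n. (stirling_rem (x + real n + 1) - stirling_rem (real n + 1)) + stirling_rem (real n + 1))
      \<longlonglongrightarrow> 0 + 0"
    by (intro tendsto_add stirling_rem_shift_LIMSEQ stirling_rem_nat_LIMSEQ x)
  then show ?thesis
    by (subst filterlim_sequentially_Suc [symmetric]) (simp add: add_ac)
qed

text \<open>A decreasing sequence with limit 0 starts at a nonnegative value, an increasing one at a
  nonpositive value.\<close>

lemma stirling_rem_bounds:
  assumes x: "x > 0"
  shows "stirling_lo x \<le> stirling_rem x" "stirling_rem x \<le> stirling_hi x"
proof -
  have "(\<lambda>n. stirling_lo (x + real n)) \<longlonglongrightarrow> 0" "(\<lambda>n. stirling_hi (x + real n)) \<longlonglongrightarrow> 0"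
    unfolding stirling_lo_def stirling_hi_def by real_asymp+
  then have lim: "(\<lambda>n. stirling_rem (x + real n) - stirling_lo (x + real n)) \<longlonglongrightarrow> 0 - 0"
      "(\<lambda>n. stirling_rem (x + real n) - stirling_hi (x + real n)) \<longlonglongrightarrow> 0 - 0"
    by - (intro tendsto_diff stirling_rem_LIMSEQ x; assumption)+
  show "stirling_lo x \<le> stirling_rem x"
    using decseq_ge[OF decseq_stirling_lo[OF x] lim(1), of 0] by simp
  show "stirling_rem x \<le> stirling_hi x"
    using incseq_le[OF incseq_stirling_hi[OF x] lim(2), of 0] by simp
qed

section \<open>The logarithm of \<Gamma>(x) / (x/e)^x and its unique zero\<close>

definition kappa_fun :: "real \<Rightarrow> real" where
  "kappa_fun x = ln_Gamma x - x * ln x + x"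

lemma kappa_eq_iff: "\<kappa> > 0 \<Longrightarrow> kappa_eq \<kappa> \<longleftrightarrow> kappa_fun \<kappa> = 0"
proof -
  assume "\<kappa> > 0"
  then have "Gamma \<kappa> = exp (ln_Gamma \<kappa>)" "(\<kappa> / exp 1) powr \<kappa> = exp (\<kappa> * ln \<kappa> - \<kappa>)"
    by (auto simp: Gamma_real_pos_exp powr_def ln_divide_pos algebra_simps)
  then show ?thesis
    by (auto simp: kappa_eq_def kappa_fun_def)
qed

text \<open>The mean value theorem on [x, x + 1] gives \<open>ln x = Digamma z\<close> for some
  \<open>z > x\<close>, and \<open>Digamma\<close> is strictly increasing.\<close>

lemma Digamma_less_ln:
  assumes "x > 0"
  shows "Digamma x < ln (x :: real)"
proof -
  have "\<exists>z. z > x \<and> z < x + 1 \<and> ln_Gamma (x + 1) - ln_Gamma x = (x + 1 - x) * Digamma z"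
    using assms by (intro MVT2) (auto intro!: derivative_eq_intros)
  then obtain z where "z > x" "ln x = Digamma z"
    using ln_Gamma_real_plus1[OF assms] by auto
  then show ?thesis
    using Digamma_real_strict_mono[OF assms] by simp
qed

lemma kappa_fun_deriv: "x > 0 \<Longrightarrow> (kappa_fun has_real_derivative Digamma x - ln x) (at x)"
  unfolding kappa_fun_def by (auto intro!: derivative_eq_intros)

lemma kappa_fun_strict_antimono:
  assumes "x > 0" "x < y"
  shows "kappa_fun y < kappa_fun x"
proof (rule DERIV_neg_imp_decreasing[OF assms(2)])
  fix z assume "x \<le> z" "z \<le> y"
  then show "\<exists>d. (kappa_fun has_real_derivative d) (at z) \<and> d < 0"
    using kappa_fun_deriv[of z] Digamma_less_ln[of z] assms
    by (intro exI[of _ "Digamma z - ln z"]) auto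
qed

text \<open>In this form a zero is a point where x / (2 pi) equals the exponential of twice the
  small remainder; this is why it lies slightly above 2 pi and can be located numerically.\<close>

lemma kappa_fun_eq:
  assumes "x > 0"
  shows "kappa_fun x = stirling_rem x - ln (x / (2 * pi)) / 2"
  using assms by (simp add: kappa_fun_def stirling_rem_def ln_divide_pos algebra_simps diff_divide_distrib)

lemma kappa_fun_lower: "kappa_fun 6.4475 > 0"
proof -
  \<comment> \<open>1.0261514956 is 6.4475 / (2 pi) rounded up. Half of the bound 0.0258154 is
    0.0129077, which stays below the value 0.01291453 used for \<open>stirling_lo\<close>.\<close>
  have "ln (6.4475 / (2 * pi)) \<le> ln (1.0261514956 :: real)"
    using pi_approx by (subst ln_le_cancel_iff) (auto simp: field_simps)
  also have "\<dots> < 0.0258154"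
    using ln_approx_bounds[of "1.0261514956" 2] by (simp add: eval_nat_numeral field_simps)
  finally have "ln (6.4475 / (2 * pi)) < 0.0258154" .
  moreover have "stirling_lo 6.4475 > 0.01291453"
    by (simp add: stirling_lo_def field_simps)
  ultimately show ?thesis
    using stirling_rem_bounds(1)[of "6.4475"] by (simp add: kappa_fun_eq)
qed

lemma kappa_fun_upper: "kappa_fun 6.4476 < 0"
proof -
  \<comment> \<open>1.026167411 is 6.4476 / (2 pi) rounded down. Half of 0.0258309 is 0.01291545,
    which exceeds the value 0.01291442 used for \<open>stirling_hi\<close>.\<close>
  have "0.0258309 < ln (1.026167411 :: real)"
    using ln_approx_bounds[of "1.026167411" 2] by (simp add: eval_nat_numeral field_simps)
  also have "\<dots> \<le> ln (6.4476 / (2 * pi))"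
    using pi_approx by (subst ln_le_cancel_iff) (auto simp: field_simps)
  finally have "ln (6.4476 / (2 * pi)) > 0.0258309" .
  moreover have "stirling_hi 6.4476 < 0.01291442"
    by (simp add: stirling_hi_def field_simps)
  ultimately show ?thesis
    using stirling_rem_bounds(2)[of "6.4476"] by (simp add: kappa_fun_eq)
qed

lemma kappa1_properties:
  shows "\<exists>!\<kappa>. \<kappa> > 0 \<and> kappa_eq \<kappa>" and "6.4475 \<le> kappa1" and "kappa1 < 6.4476"
proof -
  have "\<exists>x. 6.4475 \<le> x \<and> x \<le> 6.4476 \<and> kappa_fun x = 0"
    using kappa_fun_lower kappa_fun_upper
    by (intro IVT2) (auto intro: DERIV_isCont[OF kappa_fun_deriv])
  then obtain k where k: "6.4475 \<le> k" "k \<le> 6.4476" "kappa_fun k = 0"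
    by blast
  have uniq: "x = k" if "x > 0 \<and> kappa_eq x" for x
    using that k kappa_fun_strict_antimono[of x k] kappa_fun_strict_antimono[of k x]
    by (cases x k rule: linorder_cases) (auto simp: kappa_eq_iff)
  have sol: "k > 0 \<and> kappa_eq k"
    using k by (simp add: kappa_eq_iff)
  show "\<exists>!\<kappa>. \<kappa> > 0 \<and> kappa_eq \<kappa>"
    using sol uniq by blast
  have "kappa1 = k"
    unfolding kappa1_def using sol uniq by (rule the_equality)
  \<comment> \<open>The intermediate value theorem gives a zero in the closed interval; the right
    endpoint is excluded since \<open>kappa_fun\<close> is negative there.\<close>
  moreover have "k \<noteq> 6.4476"
    using k kappa_fun_upper by force
  ultimately show "6.4475 \<le> kappa1" "kappa1 < 6.4476"
    using k by auto
qed

section \<open>Rotation invariance and moments of the weight\<close>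

lemma measurable_Complex_pair [measurable]:
  "(\<lambda>p. Complex (fst p) (snd p)) \<in> borel_measurable (borel \<Otimes>\<^sub>M borel)"
  unfolding borel_measurable_complex_iff by (simp add: complex.sel)

text \<open>Lebesgue measure is determined by its values on boxes, and a complex box corresponds to
  a product of two intervals. This opens the way to Fubini in real and imaginary parts.\<close>

lemma lborel_complex_eq_distr:
  "lborel = distr (lborel \<Otimes>\<^sub>M lborel) borel (\<lambda>p. Complex (fst p) (snd p))" (is "_ = ?M")
proof (rule lborel_eqI)
  fix l u :: complex
  assume lu: "\<And>b. b \<in> Basis \<Longrightarrow> l \<bullet> b \<le> u \<bullet> b"
  have le: "Re l \<le> Re u" "Im l \<le> Im u"
    using lu[of 1] lu[of \<i>] by (auto simp: Basis_complex_def)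
  have "(\<lambda>p. Complex (fst p) (snd p)) -` box l u = {Re l<..<Re u} \<times> {Im l<..<Im u}"
    by (auto simp: in_box_complex_iff)
  then have "emeasure ?M (box l u)
      = emeasure (lborel \<Otimes>\<^sub>M lborel) ({Re l<..<Re u} \<times> {Im l<..<Im u})"
    by (subst emeasure_distr) (auto simp: space_pair_measure)
  also have "\<dots> = ennreal ((Re u - Re l) * (Im u - Im l))"
    using le by (simp add: lborel.emeasure_pair_measure_Times ennreal_mult')
  finally show "emeasure ?M (box l u) = (\<Prod>b\<in>Basis. (u - l) \<bullet> b)"
    by (simp add: Basis_complex_def)
qed simp

lemma measurable_Complex [measurable (raw)]:
  assumes "f \<in> borel_measurable M" "g \<in> borel_measurable M"
  shows "(\<lambda>x. Complex (f x) (g x)) \<in> borel_measurable M"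
  using assms unfolding borel_measurable_complex_iff by simp

lemma nn_integral_lborel_complex:
  fixes u :: "complex \<Rightarrow> ennreal"
  assumes [measurable]: "u \<in> borel_measurable borel"
  shows "(\<integral>\<^sup>+z. u z \<partial>lborel) = (\<integral>\<^sup>+x. \<integral>\<^sup>+y. u (Complex x y) \<partial>lborel \<partial>lborel)"
    and "(\<integral>\<^sup>+z. u z \<partial>lborel) = (\<integral>\<^sup>+y. \<integral>\<^sup>+x. u (Complex x y) \<partial>lborel \<partial>lborel)"
proof -
  have "(\<integral>\<^sup>+z. u z \<partial>lborel) = (\<integral>\<^sup>+p. u (Complex (fst p) (snd p)) \<partial>(lborel \<Otimes>\<^sub>M lborel))"
    by (subst lborel_complex_eq_distr) (simp add: nn_integral_distr)
  then show "(\<integral>\<^sup>+z. u z \<partial>lborel) = (\<integral>\<^sup>+x. \<integral>\<^sup>+y. u (Complex x y) \<partial>lborel \<partial>lborel)"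
    by (simp add: lborel.nn_integral_fst [symmetric])
  then show "(\<integral>\<^sup>+z. u z \<partial>lborel) = (\<integral>\<^sup>+y. \<integral>\<^sup>+x. u (Complex x y) \<partial>lborel \<partial>lborel)"
    by (subst (asm) lborel_pair.Fubini') simp_all
qed

text \<open>On each horizontal line the shear is a translation, so integrating over that line first
  gives the claim.\<close>

lemma nn_integral_shear_Re:
  fixes u :: "complex \<Rightarrow> ennreal"
  assumes [measurable]: "u \<in> borel_measurable borel"
  shows "(\<integral>\<^sup>+z. u (Complex (Re z + t * Im z) (Im z)) \<partial>lborel) = (\<integral>\<^sup>+z. u z \<partial>lborel)"
proof -
  have "(\<integral>\<^sup>+x. u (Complex (x + t * y) y) \<partial>lborel) = (\<integral>\<^sup>+x. u (Complex x y) \<partial>lborel)" for y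
    using nn_integral_real_affine[of "\<lambda>x. u (Complex x y)" 1 "t * y"] by (simp add: add.commute)
  then show ?thesis
    by (simp add: nn_integral_lborel_complex(2))
qed

lemma nn_integral_shear_Im:
  fixes u :: "complex \<Rightarrow> ennreal"
  assumes [measurable]: "u \<in> borel_measurable borel"
  shows "(\<integral>\<^sup>+z. u (Complex (Re z) (Im z + t * Re z)) \<partial>lborel) = (\<integral>\<^sup>+z. u z \<partial>lborel)"
proof -
  have "(\<integral>\<^sup>+y. u (Complex x (y + t * x)) \<partial>lborel) = (\<integral>\<^sup>+y. u (Complex x y) \<partial>lborel)" for x
    using nn_integral_real_affine[of "\<lambda>y. u (Complex x y)" 1 "t * x"] by (simp add: add.commute)
  then show ?thesis
    by (simp add: nn_integral_lborel_complex(1))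
qed

text \<open>A rotation by an angle other than \<open>\<pi>\<close> is a product of three shears.\<close>

lemma nn_integral_rotate_aux:
  fixes u :: "complex \<Rightarrow> ennreal"
  assumes [measurable]: "u \<in> borel_measurable borel" and w: "norm w = 1" "w \<noteq> -1"
  shows "(\<integral>\<^sup>+z. u (w * z) \<partial>lborel) = (\<integral>\<^sup>+z. u z \<partial>lborel)"
proof -
  have sq: "(Re w)\<^sup>2 + (Im w)\<^sup>2 = 1"
    using w(1) cmod_power2[of w] by simp
  have "Re w \<noteq> -1"
    using sq w(2) by (auto simp: complex_eq_iff)
  \<comment> \<open>For w = exp(i \<theta>) this is -tan(\<theta>/2), the parameter of the outer two
    shears; the middle one has parameter sin \<theta>.\<close>
  define t where "t = - (Im w / (1 + Re w))"
  have t: "t * (1 + Re w) = - Im w" "1 + Im w * t = Re w"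
  proof -
    have nz: "1 + Re w \<noteq> 0" using \<open>Re w \<noteq> -1\<close> by auto
    show "t * (1 + Re w) = - Im w"
      using nz by (simp add: t_def)
    have "(1 + Im w * t) * (1 + Re w) = Re w * (1 + Re w)"
      unfolding distrib_right mult.assoc \<open>t * (1 + Re w) = - Im w\<close> using sq by algebra
    then show "1 + Im w * t = Re w"
      using nz by simp
  qed
  let ?A = "\<lambda>z. Complex (Re z + t * Im z) (Im z)"
  let ?B = "\<lambda>z. Complex (Re z) (Im z + Im w * Re z)"
  have "w * z = ?A (?B (?A z))" for z
  proof (rule complex_eqI)
    have "Im (?A (?B (?A z))) = Im w * Re z + (1 + Im w * t) * Im z"
      by (simp add: algebra_simps)
    then show "Im (w * z) = Im (?A (?B (?A z)))"
      by (simp only: t) simp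
    have "Re (?A (?B (?A z))) = (1 + Im w * t) * Re z + t * (1 + (1 + Im w * t)) * Im z"
      by (simp add: algebra_simps)
    then show "Re (w * z) = Re (?A (?B (?A z)))"
      by (simp only: t) simp
  qed
  then have "(\<integral>\<^sup>+z. u (w * z) \<partial>lborel) = (\<integral>\<^sup>+z. u (?A (?B (?A z))) \<partial>lborel)"
    by simp
  also have "\<dots> = (\<integral>\<^sup>+z. u (?A (?B z)) \<partial>lborel)"
    by (rule nn_integral_shear_Re[of "\<lambda>z. u (?A (?B z))"]) measurable
  also have "\<dots> = (\<integral>\<^sup>+z. u (?A z) \<partial>lborel)"
    by (rule nn_integral_shear_Im[of "\<lambda>z. u (?A z)"]) measurable
  also have "\<dots> = (\<integral>\<^sup>+z. u z \<partial>lborel)"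
    by (rule nn_integral_shear_Re) measurable
  finally show ?thesis .
qed

text \<open>The remaining rotation, by the angle \<pi>, is a product of two quarter turns.\<close>

lemma nn_integral_rotate:
  fixes u :: "complex \<Rightarrow> ennreal"
  assumes [measurable]: "u \<in> borel_measurable borel" and w: "norm w = 1"
  shows "(\<integral>\<^sup>+z. u (w * z) \<partial>lborel) = (\<integral>\<^sup>+z. u z \<partial>lborel)"
proof (cases "w = -1")
  case True
  have "(\<integral>\<^sup>+z. u (w * z) \<partial>lborel) = (\<integral>\<^sup>+z. u (\<i> * (\<i> * z)) \<partial>lborel)"
    by (simp add: True mult.assoc [symmetric])
  also have "\<dots> = (\<integral>\<^sup>+z. u (\<i> * z) \<partial>lborel)"
    by (rule nn_integral_rotate_aux[of "\<lambda>z. u (\<i> * z)"]) (auto simp: complex_eq_iff)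
  also have "\<dots> = (\<integral>\<^sup>+z. u z \<partial>lborel)"
    by (rule nn_integral_rotate_aux) (auto simp: complex_eq_iff)
  finally show ?thesis .
qed (rule nn_integral_rotate_aux, use w in auto)

text \<open>The disc |z|^2 \<le> x has area pi x, and half-lines generate the Borel sets. This takes
  the place of polar coordinates for radial integrands.\<close>

lemma distr_norm_power2_complex:
  "distr lborel borel (\<lambda>z::complex. (norm z)\<^sup>2)
    = density lborel (\<lambda>t. ennreal pi * indicator {0..} t)" (is "?M = ?N")
proof (rule measure_eqI_generator_eq[where E = "range atMost" and \<Omega> = UNIV and A = "\<lambda>i::nat. {..real i}"])
  show "Int_stable (range atMost :: real set set)"
  proof (rule Int_stableI_image)
    show "\<exists>c\<in>UNIV. {..a} \<inter> {..b} = {..c}" for a b :: real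
      by (intro bexI[of _ "min a b"]) auto
  qed
  have M: "emeasure ?M {..x} = ennreal (pi * max 0 x)" for x
  proof (cases "x < 0")
    case True
    have "{z::complex. (norm z)\<^sup>2 \<le> x} = {}"
      using True by (auto simp: not_le intro: less_le_trans)
    with True show ?thesis
      by (simp add: emeasure_distr vimage_def)
  next
    case False
    then have "{z::complex. (norm z)\<^sup>2 \<le> x} = cball 0 (sqrt x)"
      by (auto simp: real_le_rsqrt sqrt_ge_absD)
    with False show ?thesis
      by (simp add: emeasure_distr vimage_def emeasure_cball unit_ball_vol_2)
  qed
  have N: "emeasure ?N {..x} = ennreal (pi * max 0 x)" for x
  proof -
    have "emeasure ?N {..x} = (\<integral>\<^sup>+t. ennreal pi * indicator {0..x} t \<partial>lborel)"
      by (subst emeasure_density) (auto intro!: nn_integral_cong split: split_indicator)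
    also have "\<dots> = ennreal pi * ennreal (max 0 x)"
      by (subst nn_integral_cmult_indicator) (auto simp: emeasure_lborel_Icc_eq max_def)
    finally show ?thesis
      by (simp add: ennreal_mult')
  qed
  show "emeasure ?M X = emeasure ?N X" if "X \<in> range atMost" for X
    using that M N by auto
  show "emeasure ?M {..real i} \<noteq> \<infinity>" for i
    using M[of "real i"] by simp
  show "(\<Union>i. {..real i}) = UNIV"
    by (auto intro: real_arch_simple)
qed (auto simp: borel_eq_atMost)

text \<open>Euler's integral for \<Gamma>(s) after the substitution of \<alpha> t for t.\<close>

lemma nn_integral_powr_exp:
  assumes "\<alpha> > 0" "s > 0"
  shows "(\<integral>\<^sup>+t. ennreal (t powr (s - 1) * exp (- \<alpha> * t)) * indicator {0..} t \<partial>lborel)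
    = ennreal (Gamma s / \<alpha> powr s)"
proof -
  let ?f = "\<lambda>t. ennreal (t powr (s - 1) / exp t) * indicator {0..} t"
  have "ennreal (Gamma s) = integral\<^sup>N lborel ?f"
    by (rule nn_integral_has_integral_lebesgue'[symmetric])
      (auto intro: Gamma_integral_real assms)
  also have "\<dots> = \<bar>\<alpha>\<bar> * (\<integral>\<^sup>+t. ?f (0 + \<alpha> * t) \<partial>lborel)"
    using assms by (intro nn_integral_real_affine) auto
  also have "(\<integral>\<^sup>+t. ?f (0 + \<alpha> * t) \<partial>lborel) = (\<integral>\<^sup>+t. ennreal (\<alpha> powr (s - 1)) *
      (ennreal (t powr (s - 1) * exp (- \<alpha> * t)) * indicator {0..} t) \<partial>lborel)"
    using assms
    by (intro nn_integral_cong)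
      (auto split: split_indicator simp: zero_le_mult_iff powr_mult exp_minus ennreal_mult' [symmetric] field_simps)
  also have "\<dots> = ennreal (\<alpha> powr (s - 1)) *
      (\<integral>\<^sup>+t. ennreal (t powr (s - 1) * exp (- \<alpha> * t)) * indicator {0..} t \<partial>lborel)" (is "_ = _ * ?I")
    by (intro nn_integral_cmult) measurable
  finally have "ennreal (Gamma s) = ennreal (\<alpha> powr s) * ?I"
    using assms by (simp add: mult.assoc [symmetric] ennreal_mult' [symmetric] powr_mult_base)
  \<comment> \<open>Multiplying by the finite inverse replaces cancellation in the extended
    nonnegative reals.\<close>
  then have "ennreal (1 / \<alpha> powr s) * ennreal (Gamma s) = ennreal (1 / \<alpha> powr s) * ennreal (\<alpha> powr s) * ?I"
    by (simp add: mult.assoc)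
  then show ?thesis
    using assms by (simp add: ennreal_mult' [symmetric])
qed

lemma fock_weight_measurable [measurable]: "fock_weight \<alpha> \<beta> \<in> borel_measurable borel"
  unfolding fock_weight_def by measurable

lemma fock_weight_nonneg [simp]: "fock_weight \<alpha> \<beta> z \<ge> 0"
  by (simp add: fock_weight_def)

lemma fock_moment:
  assumes "\<alpha> > 0" "\<beta> > -1"
  shows "(\<integral>\<^sup>+z. ennreal (norm z ^ (2 * n) * fock_weight \<alpha> \<beta> z) \<partial>lborel)
    = ennreal (pi * Gamma (real n + (\<beta> + 1)) / \<alpha> powr (real n + (\<beta> + 1)))"
proof -
  define s where "s = real n + (\<beta> + 1)"
  have s: "s > 0" using assms by (simp add: s_def)
  let ?h = "\<lambda>t::real. ennreal (t powr (s - 1) * exp (- \<alpha> * t))"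
  have "(\<integral>\<^sup>+z. ennreal (norm z ^ (2 * n) * fock_weight \<alpha> \<beta> z) \<partial>lborel)
      = (\<integral>\<^sup>+z. ?h ((norm z)\<^sup>2) \<partial>(lborel :: complex measure))"
  proof (intro nn_integral_cong arg_cong[where f = ennreal])
    fix z :: complex
    show "norm z ^ (2 * n) * fock_weight \<alpha> \<beta> z = ((norm z)\<^sup>2) powr (s - 1) * exp (- \<alpha> * (norm z)\<^sup>2)"
    \<comment> \<open>At the origin both sides are 0 because 0 \<open>powr\<close> anything is
      0.\<close>
    proof (cases "z = 0")
      case False
      then have "norm z ^ (2 * n) = norm z powr (2 * real n)" "(norm z)\<^sup>2 = norm z powr 2"
        using powr_realpow[of "norm z" "2 * n"] powr_realpow[of "norm z" 2] by (simp_all del: powr_numeral)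
      then show ?thesis
        by (simp add: fock_weight_def s_def powr_powr powr_add [symmetric] algebra_simps del: powr_numeral)
    qed (simp add: fock_weight_def)
  qed
  also have "\<dots> = integral\<^sup>N (distr lborel borel (\<lambda>z::complex. (norm z)\<^sup>2)) ?h"
    by (subst nn_integral_distr) auto
  also have "\<dots> = (\<integral>\<^sup>+t. ennreal pi * (?h t * indicator {0..} t) \<partial>lborel)"
    unfolding distr_norm_power2_complex
    by (subst nn_integral_density) (auto intro!: nn_integral_cong split: split_indicator)
  also have "\<dots> = ennreal pi * ennreal (Gamma s / \<alpha> powr s)"
    by (subst nn_integral_cmult, measurable, simp only: nn_integral_powr_exp[OF assms(1) s])
  finally show ?thesis
    by (simp add: s_def ennreal_mult' [symmetric])
qed

section \<open>Circle means of power series\<close>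

lemma norm_circlepath_0 [simp]: "r \<ge> 0 \<Longrightarrow> norm (circlepath 0 r t) = r"
  by (simp add: circlepath norm_mult)

lemma continuous_on_circlepath [continuous_intros]: "continuous_on S (circlepath z r)"
  unfolding circlepath by (intro continuous_intros)

text \<open>Cauchy's formula at the centre: on the circle, dz / z is 2 pi i dt.\<close>

lemma has_integral_circle_mean:
  assumes hol: "u holomorphic_on ball 0 S" and r: "0 < r" "r < S"
  shows "((\<lambda>t. u (circlepath 0 r t)) has_integral u 0) {0..1}"
proof -
  have "cball 0 r \<subseteq> ball 0 S" "ball 0 r \<subseteq> ball (0::complex) S"
    using r by auto
  then have "((\<lambda>z. u z / (z - 0)) has_contour_integral (2 * of_real pi * \<i> * u 0)) (circlepath 0 r)"
    using r hol by (intro Cauchy_integral_circlepath)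
      (auto intro: holomorphic_on_subset holomorphic_on_imp_continuous_on continuous_on_subset)
  then have "((\<lambda>t. u (circlepath 0 r t) / circlepath 0 r t *
      vector_derivative (circlepath 0 r) (at t within {0..1})) has_integral (2 * of_real pi * \<i> * u 0)) {0..1}"
    by (simp add: has_contour_integral_def)
  also have "?this \<longleftrightarrow> ((\<lambda>t. (2 * of_real pi * \<i>) * u (circlepath 0 r t)) has_integral
      (2 * of_real pi * \<i> * u 0)) {0..1}"
    using r by (intro has_integral_cong) (auto simp: vector_derivative_circlepath01, simp add: circlepath)
  finally have "((\<lambda>t. inverse (2 * of_real pi * \<i>) * ((2 * of_real pi * \<i>) * u (circlepath 0 r t)))
      has_integral inverse (2 * of_real pi * \<i>) * (2 * of_real pi * \<i> * u 0)) {0..1}"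
    by (rule has_integral_mult_right)
  then show ?thesis
    by (simp add: field_simps)
qed

text \<open>Since \<open>circlepath\<close> has constant speed on [0, 1], this is the mean of |u|^2
  over the circle, that is, the squared norm for normalised arc length.\<close>

definition circle_norm_sq :: "(complex \<Rightarrow> complex) \<Rightarrow> real \<Rightarrow> real" where
  "circle_norm_sq u r = integral {0..1} (\<lambda>t. (norm (u (circlepath 0 r t)))\<^sup>2)"

lemma circle_norm_sq_integrable:
  assumes "continuous_on (sphere 0 r) u" "r > 0"
  shows "(\<lambda>t. (norm (u (circlepath 0 r t)))\<^sup>2) integrable_on {0..1}"
  using assms
  by (intro integrable_continuous_interval continuous_intros continuous_on_compose2[OF assms(1)]) auto

lemma circle_norm_sq_has_integral:
  assumes "continuous_on (sphere 0 r) u" "r > 0"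
  shows "((\<lambda>t. (norm (u (circlepath 0 r t)))\<^sup>2) has_integral circle_norm_sq u r) {0..1}"
  unfolding circle_norm_sq_def using circle_norm_sq_integrable[OF assms] by (rule integrable_integral)

lemma circle_norm_sq_mono:
  assumes "continuous_on (sphere 0 r) u" "continuous_on (sphere 0 r) v" "r > 0"
    and "\<And>z. norm z = r \<Longrightarrow> norm (u z) \<le> norm (v z)"
  shows "circle_norm_sq u r \<le> circle_norm_sq v r"
  unfolding circle_norm_sq_def using assms
  by (intro integral_le circle_norm_sq_integrable) (auto intro!: power_mono)

lemma circle_norm_sq_scale:
  assumes "\<And>z. norm z = r \<Longrightarrow> norm (u z) = k * norm (v z)" "r > 0"
  shows "circle_norm_sq u r = k\<^sup>2 * circle_norm_sq v r"
proof -
  have "circle_norm_sq u r = integral {0..1} (\<lambda>t. k\<^sup>2 * (norm (v (circlepath 0 r t)))\<^sup>2)"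
    unfolding circle_norm_sq_def using assms by (intro integral_cong) (auto simp: power_mult_distrib)
  then show ?thesis
    by (simp add: circle_norm_sq_def)
qed

lemma circle_norm_sq_const: "circle_norm_sq (\<lambda>z. c) r = (norm c)\<^sup>2"
  by (simp add: circle_norm_sq_def)

text \<open>Orthogonality of \<open>F\<close> and \<open>e(1/z)/z\<close> on the circle: there \<open>1/z\<close> is the conjugate of
  \<open>z/r\<^sup>2\<close>, so their pairing is the circle mean of a holomorphic function vanishing at 0.\<close>

lemma circle_norm_sq_diff:
  assumes F: "F holomorphic_on UNIV" and e: "e holomorphic_on ball 0 (1 / R)"
    and R: "0 < R" "R < r"
  shows "circle_norm_sq F r \<le> circle_norm_sq (\<lambda>z. F z - e (1 / z) / z) r"
    and "circle_norm_sq (\<lambda>z. F z - e (1 / z) / z) r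
      = circle_norm_sq F r + circle_norm_sq (\<lambda>z. e (1 / z) / z) r"
proof -
  have r: "r > 0" using R by simp
  define E where "E = (\<lambda>z. e (1 / z) / z)"
  \<comment> \<open>The holomorphic continuation of the product of F with the conjugate of e(1/z)/z
    off the circle. It lives on the disc of radius r^2 / R, which contains the circle because R < r,
    and the factor z makes it vanish at 0.\<close>
  define v where "v = (\<lambda>z. F z * (z / of_real (r\<^sup>2)) * (cnj \<circ> e \<circ> cnj) (z / of_real (r\<^sup>2)))"
  have "(cnj \<circ> e \<circ> cnj) holomorphic_on ball 0 (1 / R)"
    using e by (intro holomorphic_on_compose_cnj_cnj) (auto simp: image_image intro!: holomorphic_on_subset[OF e])
  then have "(\<lambda>z. (cnj \<circ> e \<circ> cnj) (z / of_real (r\<^sup>2))) holomorphic_on ball 0 (r\<^sup>2 / R)"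
    using r R
    by (intro holomorphic_on_compose_gen[of "\<lambda>z. z / of_real (r\<^sup>2)" _ "cnj \<circ> e \<circ> cnj", unfolded o_def[of "cnj \<circ> e \<circ> cnj"]] holomorphic_intros)
      (auto simp: norm_divide norm_power field_simps)
  then have "v holomorphic_on ball 0 (r\<^sup>2 / R)"
    unfolding v_def using r by (intro holomorphic_intros holomorphic_on_subset[OF F]) auto
  moreover have "r < r\<^sup>2 / R"
    using R by (simp add: field_simps power2_eq_square)
  ultimately have v: "((\<lambda>t. v (circlepath 0 r t)) has_integral 0) {0..1}"
    using has_integral_circle_mean[of v "r\<^sup>2 / R" r] r by (simp add: v_def)
  have inv: "1 / z = cnj (z / of_real (r\<^sup>2))" if "norm z = r" for z
    using that complex_div_cnj[of 1 z] by simp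
  have cont_inv: "continuous_on (sphere 0 r) (\<lambda>z::complex. e (1 / z))"
    using r R by (intro continuous_on_compose2[OF holomorphic_on_imp_continuous_on[OF e]] continuous_intros)
      (auto simp: norm_divide field_simps)
  have contE: "continuous_on (sphere 0 r) E"
    unfolding E_def using r by (intro continuous_intros cont_inv) auto
  have contF: "continuous_on (sphere 0 r) F"
    using holomorphic_on_imp_continuous_on[OF F] continuous_on_subset by blast
  have eq: "(norm (F z - E z))\<^sup>2 = (norm (F z))\<^sup>2 + (norm (E z))\<^sup>2 - 2 * Re (v z)" if z: "norm z = r" for z
  proof -
    have "E z = cnj (z / of_real (r\<^sup>2)) * e (cnj (z / of_real (r\<^sup>2)))"
      unfolding E_def inv[OF z, symmetric] by simp
    then have "F z * cnj (E z) = v z"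
      by (simp add: v_def)
    moreover have "(norm (F z - E z))\<^sup>2 = (norm (F z))\<^sup>2 + (norm (E z))\<^sup>2 - 2 * Re (F z * cnj (E z))"
      by (simp only: cmod_power2 minus_complex.sel times_complex.sel complex_cnj) (simp add: power2_eq_square algebra_simps)
    ultimately show ?thesis by simp
  qed
  have "((\<lambda>t. (norm (F (circlepath 0 r t)))\<^sup>2 + (norm (E (circlepath 0 r t)))\<^sup>2
      - 2 * Re (v (circlepath 0 r t))) has_integral circle_norm_sq F r + circle_norm_sq E r - 2 * 0) {0..1}"
    using has_integral_Re[OF v] r contE contF
    by (intro has_integral_diff has_integral_add has_integral_mult_right circle_norm_sq_has_integral) auto
  then have "((\<lambda>t. (norm (F (circlepath 0 r t) - E (circlepath 0 r t)))\<^sup>2)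
      has_integral circle_norm_sq F r + circle_norm_sq E r - 2 * 0) {0..1}"
    using r by (simp add: eq)
  then show *: "circle_norm_sq (\<lambda>z. F z - e (1 / z) / z) r
      = circle_norm_sq F r + circle_norm_sq (\<lambda>z. e (1 / z) / z) r"
    unfolding circle_norm_sq_def[of "\<lambda>z. F z - e (1 / z) / z"] E_def by (simp add: integral_unique)
  have "circle_norm_sq (\<lambda>z. e (1 / z) / z) r \<ge> 0"
    unfolding circle_norm_sq_def by (intro integral_nonneg circle_norm_sq_integrable[OF contE[unfolded E_def]] r) auto
  with * show "circle_norm_sq F r \<le> circle_norm_sq (\<lambda>z. F z - e (1 / z) / z) r"
    by simp
qed

section \<open>Everywhere convergent power series and Parseval's identity\<close>

definition power_sum :: "(nat \<Rightarrow> complex) \<Rightarrow> complex \<Rightarrow> complex" where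
  "power_sum a z = (\<Sum>n. a n * z ^ n)"

lemma summable_powser_shift:
  fixes a :: "nat \<Rightarrow> complex"
  assumes "\<And>z. summable (\<lambda>n. a n * z ^ n)"
  shows "summable (\<lambda>n. a (n + N) * z ^ n)"
proof (induction N)
  case (Suc N)
  then show ?case
    using powser_split_head(3)[of "\<lambda>n. a (n + N)" z] by simp
qed (simp add: assms)

lemma power_sum_split:
  assumes "\<And>z. summable (\<lambda>n. a n * z ^ n)"
  shows "power_sum a z = (\<Sum>n<N. a n * z ^ n) + z ^ N * power_sum (\<lambda>n. a (n + N)) z"
proof -
  have "power_sum a z = (\<Sum>n. a (n + N) * z ^ (n + N)) + (\<Sum>n<N. a n * z ^ n)"
    unfolding power_sum_def by (rule suminf_split_initial_segment[OF assms])
  also have "(\<Sum>n. a (n + N) * z ^ (n + N)) = z ^ N * power_sum (\<lambda>n. a (n + N)) z"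
    unfolding power_sum_def
    by (subst suminf_mult [OF summable_powser_shift[OF assms], symmetric]) (simp add: power_add mult_ac)
  finally show ?thesis by simp
qed

lemma power_sum_holomorphic:
  assumes "\<And>z. summable (\<lambda>n. a n * z ^ n)"
  shows "power_sum a holomorphic_on UNIV"
proof -
  have "(power_sum a has_field_derivative (\<Sum>n. diffs a n * z ^ n)) (at z)" for z
    unfolding power_sum_def[abs_def] by (rule termdiffs_strong_converges_everywhere[OF assms])
  then show ?thesis
    by (auto simp: holomorphic_on_open)
qed

lemma entire_eq_power_sum:
  assumes "f holomorphic_on UNIV"
  obtains a where "\<And>z. summable (\<lambda>n. a n * z ^ n)" "f = power_sum a"
proof
  have *: "(\<lambda>n. (deriv ^^ n) f 0 / fact n * z ^ n) sums f z" for z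
    using holomorphic_power_series[of f 0 "norm z + 1" z] holomorphic_on_subset[OF assms] by auto
  show "summable (\<lambda>n. (deriv ^^ n) f 0 / fact n * z ^ n)" for z
    using * by (rule sums_summable)
  show "f = power_sum (\<lambda>n. (deriv ^^ n) f 0 / fact n)"
    unfolding power_sum_def using * by (auto simp: sums_iff)
qed

text \<open>Dividing by z turns the sum into u + c/z, whose two terms are orthogonal by
  \<open>circle_norm_sq_diff\<close> with the constant function \<open>e = -c\<close>; as e is
  entire, any inner radius such as r/2 serves.\<close>

lemma circle_norm_sq_const_plus:
  assumes "u holomorphic_on UNIV" "r > 0"
  shows "circle_norm_sq (\<lambda>z. c + z * u z) r = (norm c)\<^sup>2 + r\<^sup>2 * circle_norm_sq u r"
proof -
  have "norm (c + z * u z) = r * norm (u z - (- c) / z)" if "norm z = r" for z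
  proof -
    have "z \<noteq> 0" using that assms(2) by auto
    then have "c + z * u z = z * (u z - (- c) / z)"
      by (simp add: field_simps)
    then show ?thesis
      using that by (simp only: norm_mult)
  qed
  then have "circle_norm_sq (\<lambda>z. c + z * u z) r = r\<^sup>2 * circle_norm_sq (\<lambda>z. u z - (- c) / z) r"
    using assms(2) by (intro circle_norm_sq_scale) auto
  also have "circle_norm_sq (\<lambda>z. u z - (- c) / z) r = circle_norm_sq u r + circle_norm_sq (\<lambda>z. - c / z) r"
    using circle_norm_sq_diff(2)[OF assms(1), of "\<lambda>_. - c" "r / 2" r] assms(2) by simp
  also have "circle_norm_sq (\<lambda>z. - c / z) r = (1 / r)\<^sup>2 * circle_norm_sq (\<lambda>_. c) r"
    using assms(2) by (intro circle_norm_sq_scale) (auto simp: norm_divide)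
  finally show ?thesis
    using assms(2) by (simp add: circle_norm_sq_const distrib_left power_divide)
qed

lemma circle_norm_sq_power_sum_split:
  assumes "\<And>z. summable (\<lambda>n. a n * z ^ n)" "r > 0"
  shows "circle_norm_sq (power_sum a) r
    = (\<Sum>n<N. (norm (a n))\<^sup>2 * r ^ (2 * n)) + r ^ (2 * N) * circle_norm_sq (power_sum (\<lambda>n. a (n + N))) r"
proof (induction N)
  case (Suc N)
  have "power_sum (\<lambda>n. a (n + N)) = (\<lambda>z. a N + z * power_sum (\<lambda>n. a (n + Suc N)) z)"
    using power_sum_split[OF summable_powser_shift[OF assms(1)], of N _ 1] by (auto simp: fun_eq_iff add_ac)
  moreover have "power_sum (\<lambda>n. a (n + Suc N)) holomorphic_on UNIV"
    by (intro power_sum_holomorphic summable_powser_shift assms)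
  ultimately have "circle_norm_sq (power_sum (\<lambda>n. a (n + N))) r
      = (norm (a N))\<^sup>2 + r\<^sup>2 * circle_norm_sq (power_sum (\<lambda>n. a (n + Suc N))) r"
    by (simp add: circle_norm_sq_const_plus assms(2))
  then show ?case
    unfolding Suc.IH by (simp add: algebra_simps power2_eq_square)
qed simp

lemma summable_norm_powser:
  fixes a :: "nat \<Rightarrow> complex"
  assumes "\<And>z. summable (\<lambda>n. a n * z ^ n)" "r \<ge> 0"
  shows "summable (\<lambda>n. norm (a n) * r ^ n)"
proof -
  have "summable (\<lambda>n. norm (a n * of_real r ^ n))"
    using powser_insidea[OF assms(1)[of "of_real (r + 1)"], of "of_real r"] assms(2) by simp
  then show ?thesis
    using assms(2) by (simp add: norm_mult norm_power)
qed

text \<open>Parseval's identity: coefficients are split off one at a time, and what remains is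
  controlled uniformly on the circle by absolute convergence.\<close>

theorem circle_norm_sq_power_sum:
  assumes a: "\<And>z. summable (\<lambda>n. a n * z ^ n)" and r: "r > 0"
  shows "(\<lambda>n. (norm (a n))\<^sup>2 * r ^ (2 * n)) sums circle_norm_sq (power_sum a) r"
proof -
  \<comment> \<open>The tail of the absolutely convergent series bounds the tail of the power series
    at every point of the circle.\<close>
  define \<tau> where "\<tau> = (\<lambda>N. \<Sum>n. norm (a (n + N)) * r ^ (n + N))"
  have sm: "summable (\<lambda>n. norm (a n) * r ^ n)"
    using summable_norm_powser[OF a] r by simp
  have "\<tau> \<longlonglongrightarrow> 0"
    unfolding \<tau>_def by (rule suminf_exist_split2[OF sm])
  then have \<tau>: "(\<lambda>N. (\<tau> N)\<^sup>2) \<longlonglongrightarrow> 0"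
    using tendsto_power[of \<tau> 0 sequentially 2] by simp
  let ?T = "\<lambda>N. r ^ (2 * N) * circle_norm_sq (power_sum (\<lambda>n. a (n + N))) r"
  have cont: "continuous_on (sphere 0 r) (power_sum (\<lambda>n. a (n + N)))" for N
    using holomorphic_on_imp_continuous_on[OF power_sum_holomorphic[OF summable_powser_shift[OF a]]]
      continuous_on_subset by blast
  have T: "0 \<le> ?T N \<and> ?T N \<le> (\<tau> N)\<^sup>2" for N
  proof
    show "0 \<le> ?T N"
      unfolding circle_norm_sq_def using r
      by (intro mult_nonneg_nonneg integral_nonneg circle_norm_sq_integrable cont) auto
    have smN: "summable (\<lambda>n. norm (a (n + N)) * r ^ (n + N))"
      using sm by (subst summable_iff_shift)
    have "norm (z ^ N * power_sum (\<lambda>n. a (n + N)) z) \<le> norm (complex_of_real (\<tau> N))" if z: "norm z = r" for z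
    proof -
      have "z ^ N * power_sum (\<lambda>n. a (n + N)) z = (\<Sum>n. a (n + N) * z ^ (n + N))"
        unfolding power_sum_def
        by (subst suminf_mult [OF summable_powser_shift[OF a], symmetric]) (simp add: power_add mult_ac)
      also have "norm \<dots> \<le> (\<Sum>n. norm (a (n + N) * z ^ (n + N)))"
        using smN z by (intro summable_norm) (simp add: norm_mult norm_power)
      also have "\<dots> = \<tau> N"
        using z by (simp add: \<tau>_def norm_mult norm_power)
      finally show ?thesis by simp
    qed
    then have "circle_norm_sq (\<lambda>z. z ^ N * power_sum (\<lambda>n. a (n + N)) z) r \<le> circle_norm_sq (\<lambda>_. of_real (\<tau> N)) r"
      using r by (intro circle_norm_sq_mono continuous_intros cont) auto
    moreover have "circle_norm_sq (\<lambda>z. z ^ N * power_sum (\<lambda>n. a (n + N)) z) r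
        = (r ^ N)\<^sup>2 * circle_norm_sq (power_sum (\<lambda>n. a (n + N))) r"
      using r by (intro circle_norm_sq_scale) (auto simp: norm_mult norm_power)
    ultimately show "?T N \<le> (\<tau> N)\<^sup>2"
      by (simp add: circle_norm_sq_const power_mult [symmetric] mult.commute)
  qed
  have "?T \<longlonglongrightarrow> 0"
    by (rule tendsto_sandwich[OF _ _ tendsto_const \<tau>]) (use T in auto)
  then have "(\<lambda>N. circle_norm_sq (power_sum a) r - ?T N) \<longlonglongrightarrow> circle_norm_sq (power_sum a) r - 0"
    by (intro tendsto_diff tendsto_const)
  moreover have "circle_norm_sq (power_sum a) r - ?T N = (\<Sum>n<N. (norm (a n))\<^sup>2 * r ^ (2 * n))" for N
    using circle_norm_sq_power_sum_split[OF a r, of N] by simp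
  ultimately show ?thesis
    by (simp add: sums_def)
qed

text \<open>On the circle, \<open>?F\<close> differs from k(1/z) \<open>?G\<close> by a series in
  negative powers of z only. Adding negative powers to an entire function can only increase its
  circle mean, and multiplication by k(1/z) can only decrease it.\<close>

lemma circle_norm_sq_tail_le:
  assumes a: "\<And>z. summable (\<lambda>n. a n * z ^ n)" and b: "\<And>z. summable (\<lambda>n. b n * z ^ n)"
    and k: "k holomorphic_on ball 0 (1 / R)" "\<And>w. w \<in> ball 0 (1 / R) \<Longrightarrow> norm (k w) \<le> 1"
    and eq: "\<And>z. norm z > R \<Longrightarrow> power_sum a z = k (1 / z) * power_sum b z"
    and R: "0 < R" "R < r"
  shows "circle_norm_sq (power_sum (\<lambda>n. a (n + N))) r \<le> circle_norm_sq (power_sum (\<lambda>n. b (n + N))) r"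
proof -
  let ?F = "power_sum (\<lambda>n. a (n + N))" and ?G = "power_sum (\<lambda>n. b (n + N))"
  \<comment> \<open>The first N coefficients contribute (k b_n - a_n) z^n; after division by z^N
    this is a power of 1/z with exponent N - n \<ge> 1, of which one factor 1/z is kept outside
    e.\<close>
  define e where "e = (\<lambda>w. \<Sum>n<N. (k w * b n - a n) * w ^ (N - Suc n))"
  have hol: "?F holomorphic_on UNIV" "?G holomorphic_on UNIV"
    by (intro power_sum_holomorphic summable_powser_shift a b)+
  have e: "e holomorphic_on ball 0 (1 / R)"
    unfolding e_def by (intro holomorphic_intros k)
  have hG: "?F z - e (1 / z) / z = k (1 / z) * ?G z" if z: "norm z = r" for z
  proof -
    have nz: "z \<noteq> 0" using z R by auto
    have "z ^ N * (e (1 / z) / z) = (\<Sum>n<N. (k (1 / z) * b n - a n) * z ^ n)"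
      unfolding e_def sum_divide_distrib sum_distrib_left
    proof (rule sum.cong)
      fix n assume "n \<in> {..<N}"
      then have "z ^ N = z ^ (n + 1 + (N - Suc n))"
        by simp
      then have "z ^ N = z ^ n * z * z ^ (N - Suc n)"
        by (simp only: power_add power_one_right)
      then show "z ^ N * ((k (1 / z) * b n - a n) * (1 / z) ^ (N - Suc n) / z) = (k (1 / z) * b n - a n) * z ^ n"
        using nz by (simp add: power_one_over)
    qed simp
    also have "\<dots> = k (1 / z) * (\<Sum>n<N. b n * z ^ n) - (\<Sum>n<N. a n * z ^ n)"
      by (simp add: sum_subtractf sum_distrib_left algebra_simps)
    finally have s: "z ^ N * (e (1 / z) / z) = \<dots>" .
    have "(\<Sum>n<N. a n * z ^ n) + z ^ N * ?F z = k (1 / z) * ((\<Sum>n<N. b n * z ^ n) + z ^ N * ?G z)"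
      using eq[of z] power_sum_split[OF a, of z N] power_sum_split[OF b, of z N] z R by simp
    then have "z ^ N * (?F z - e (1 / z) / z) = z ^ N * (k (1 / z) * ?G z)"
      unfolding right_diff_distrib[of "z ^ N"] s by (simp add: algebra_simps)
    then show ?thesis
      using nz by simp
  qed
  have cont: "continuous_on (sphere 0 r) ?F" "continuous_on (sphere 0 r) ?G"
    using hol holomorphic_on_imp_continuous_on continuous_on_subset by blast+
  have "continuous_on (sphere 0 r) (\<lambda>z. e (1 / z))"
    using R by (intro continuous_on_compose2[OF holomorphic_on_imp_continuous_on[OF e]] continuous_intros)
      (auto simp: norm_divide field_simps)
  then have contE: "continuous_on (sphere 0 r) (\<lambda>z. ?F z - e (1 / z) / z)"
    using R by (intro continuous_intros cont) auto
  have "circle_norm_sq ?F r \<le> circle_norm_sq (\<lambda>z. ?F z - e (1 / z) / z) r"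
    by (rule circle_norm_sq_diff(1)[OF hol(1) e R])
  also have "\<dots> \<le> circle_norm_sq ?G r"
  proof (rule circle_norm_sq_mono[OF contE cont(2)])
    fix z :: complex assume z: "norm z = r"
    have "norm (k (1 / z)) \<le> 1"
      using z R by (intro k) (auto simp: norm_divide field_simps)
    then show "norm (?F z - e (1 / z) / z) \<le> norm (?G z)"
      unfolding hG[OF z] norm_mult by (intro mult_left_le_one_le) auto
  qed (use R in simp)
  finally show ?thesis .
qed

text \<open>The circle comparison holds for r > R only; both sides are power series in t = r^2
  converging everywhere, so continuity carries it to t = R^2.\<close>

lemma coeff_tail_le:
  assumes a: "\<And>z. summable (\<lambda>n. a n * z ^ n)" and b: "\<And>z. summable (\<lambda>n. b n * z ^ n)"
    and k: "k holomorphic_on ball 0 (1 / R)" "\<And>w. w \<in> ball 0 (1 / R) \<Longrightarrow> norm (k w) \<le> 1"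
    and eq: "\<And>z. norm z > R \<Longrightarrow> power_sum a z = k (1 / z) * power_sum b z"
    and R: "0 < R"
  shows "(\<Sum>n. (norm (a (n + N)))\<^sup>2 * R ^ (2 * n)) \<le> (\<Sum>n. (norm (b (n + N)))\<^sup>2 * R ^ (2 * n))"
proof -
  let ?A = "\<lambda>t. \<Sum>n. (norm (a (n + N)))\<^sup>2 * t ^ n" and ?B = "\<lambda>t. \<Sum>n. (norm (b (n + N)))\<^sup>2 * t ^ n"
  have sums: "(\<lambda>n. (norm (c (n + N)))\<^sup>2 * (r\<^sup>2) ^ n) sums circle_norm_sq (power_sum (\<lambda>n. c (n + N))) r"
    if "\<And>z. summable (\<lambda>n. c n * z ^ n)" "r > 0" for c :: "nat \<Rightarrow> complex" and r
    using circle_norm_sq_power_sum[OF summable_powser_shift[OF that(1)] that(2), of N] by (simp add: power_mult)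
  have cont: "isCont (\<lambda>t. \<Sum>n. (norm (c (n + N)))\<^sup>2 * t ^ n) (R\<^sup>2)"
    if "\<And>z. summable (\<lambda>n. c n * z ^ n)" for c :: "nat \<Rightarrow> complex"
  proof (rule isCont_powser)
    show "summable (\<lambda>n. (norm (c (n + N)))\<^sup>2 * ((R + 1)\<^sup>2) ^ n)"
      using sums[OF that, of "R + 1"] R by (auto dest: sums_summable)
    show "norm (R\<^sup>2) < norm ((R + 1)\<^sup>2)"
      using R by (simp add: power_strict_mono)
  qed
  have "?A (R\<^sup>2) \<le> ?B (R\<^sup>2)"
  proof (rule tendsto_le)
    show "(?A \<longlongrightarrow> ?A (R\<^sup>2)) (at_right (R\<^sup>2))" "(?B \<longlongrightarrow> ?B (R\<^sup>2)) (at_right (R\<^sup>2))"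
      using cont[OF a] cont[OF b] by (auto simp: isCont_def intro: filterlim_mono at_le)
    show "\<forall>\<^sub>F t in at_right (R\<^sup>2). ?A t \<le> ?B t"
      using eventually_at_right_less
    proof eventually_elim
      case (elim t)
      define r where "r = sqrt t"
      have "R < r" "t = r\<^sup>2"
        using elim R by (auto simp: r_def real_less_rsqrt order_less_trans[OF _ elim, THEN less_imp_le])
      moreover from this have "?A (r\<^sup>2) = circle_norm_sq (power_sum (\<lambda>n. a (n + N))) r"
          "?B (r\<^sup>2) = circle_norm_sq (power_sum (\<lambda>n. b (n + N))) r"
        using sums[OF a, of r] sums[OF b, of r] R by (auto simp: sums_iff)
      ultimately show ?case
        using circle_norm_sq_tail_le[OF a b k eq R, of r N] by simp
    qed
  qed simp
  then show ?thesis
    by (simp add: power_mult)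
qed

section \<open>Domination outside a disc\<close>

text \<open>Riemann's theorem on removable singularities; the bound passes to the limit at the
  point.\<close>

lemma remove_sings_bounded:
  assumes sing: "isolated_singularity_at h z" and B: "\<forall>\<^sub>F w in at z. norm (h w) \<le> B"
  shows "remove_sings h analytic_on {z}" and "norm (remove_sings h z) \<le> B"
proof -
  obtain r where r: "r > 0" "h holomorphic_on ball z r - {z}"
    using sing unfolding isolated_singularity_at_def by (auto dest: analytic_imp_holomorphic)
  then obtain g where g: "g holomorphic_on ball z r" "\<And>w. w \<in> ball z r - {z} \<Longrightarrow> g w = h w"
    using holomorphic_on_extend_bounded[OF r(2)] B by (auto simp: interior_open)
  have "isCont g z"
    using holomorphic_on_imp_continuous_on[OF g(1)] r(1) by (simp add: continuous_on_eq_continuous_at)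
  moreover have "\<forall>\<^sub>F w in at z. g w = h w"
    using eventually_at_in_open[of "ball z r" z] r(1) by (auto elim: eventually_mono intro!: g(2))
  ultimately have lim: "h \<midarrow>z\<rightarrow> g z"
    by (auto simp: isCont_def elim: Lim_transform_eventually)
  show "remove_sings h analytic_on {z}"
    by (rule remove_sings_analytic_at[OF sing lim])
  show "norm (remove_sings h z) \<le> B"
    unfolding remove_sings_eqI[OF lim] by (rule Lim_norm_ubound[OF _ lim B]) simp
qed

text \<open>The quotient f/g is bounded by 1 outside the disc, so its singularities at zeros of g,
  and then the one at infinity, are removable. Here \<open>\<beta>\<close> is merely a point
  witnessing that g is not identically 0, not the exponent of the weight.\<close>

lemma exterior_quotient:
  assumes f: "f holomorphic_on UNIV" and g: "g holomorphic_on UNIV"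
    and g0: "g \<beta> \<noteq> 0" and R: "R > 0"
    and le: "\<And>z. norm z > R \<Longrightarrow> norm (f z) \<le> norm (g z)"
  obtains k where "k holomorphic_on ball 0 (1 / R)" "\<And>w. w \<in> ball 0 (1 / R) \<Longrightarrow> norm (k w) \<le> 1"
    "\<And>z. norm z > R \<Longrightarrow> f z = k (1 / z) * g z"
proof -
  define h where "h = (\<lambda>z. f z / g z)"
  have h_analytic: "h analytic_on {z}" if "g z \<noteq> 0" for z
    unfolding h_def using that f g holomorphic_on_imp_analytic_at[of _ UNIV]
    by (intro analytic_intros) auto
  have "\<forall>\<^sub>F w in at z. g w \<noteq> 0" for z
  proof (cases "g z = 0")
    case True
    then obtain r where "r > 0" "\<And>w. w \<in> ball z r - {z} \<Longrightarrow> g w \<noteq> 0"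
      using isolated_zeros[OF g _ _ _ True _ g0] by auto
    then show ?thesis
      using eventually_at_in_open[of "ball z r" z] by (auto elim: eventually_mono)
  next
    case False
    have "isCont g z"
      using holomorphic_on_imp_continuous_on[OF g] by (simp add: continuous_on_eq_continuous_at)
    with False show ?thesis
      by (auto simp: isCont_def intro: tendsto_imp_eventually_ne)
  qed
  then have sing: "isolated_singularity_at h z" for z
  proof -
    assume ne: "\<And>z. \<forall>\<^sub>F w in at z. g w \<noteq> 0"
    obtain d where d: "d > 0" "\<And>w. w \<noteq> z \<Longrightarrow> dist w z < d \<Longrightarrow> g w \<noteq> 0"
      using ne[of z] unfolding eventually_at by auto
    have "h analytic_on {w}" if "w \<in> ball z d - {z}" for w
      using that by (intro h_analytic d) (auto simp: dist_commute)
    then have "h analytic_on ball z d - {z}"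
      by (subst analytic_on_analytic_at) blast
    with d(1) show ?thesis
      unfolding isolated_singularity_at_def by blast
  qed
  have bound: "\<forall>\<^sub>F w in at z. norm (h w) \<le> 1" if "norm z > R" for z
  proof -
    have "open {z::complex. norm z > R}"
      by (intro open_Collect_less continuous_intros)
    then have "\<forall>\<^sub>F w in at z. w \<in> {z. norm z > R}"
      using that by (intro eventually_at_in_open') auto
    then show ?thesis
      by eventually_elim (use le in \<open>auto simp: h_def norm_divide divide_le_eq_1\<close>)
  qed
  \<comment> \<open>First removal: zeros of g outside the disc.\<close>
  define Q where "Q = remove_sings h"
  have Q: "Q analytic_on {z}" "norm (Q z) \<le> 1" if "norm z > R" for z
    unfolding Q_def using remove_sings_bounded[OF sing bound[OF that]] by auto
  define q where "q = (\<lambda>w. Q (1 / w))"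
  have q: "q analytic_on {w}" "norm (q w) \<le> 1" if "w \<in> ball 0 (1 / R) - {0}" for w
  proof -
    have w: "w \<noteq> 0" "norm (1 / w) > R"
      using that R by (auto simp: norm_divide field_simps)
    have "(Q \<circ> (\<lambda>w. 1 / w)) analytic_on {w}"
      using w by (intro analytic_on_compose analytic_intros) (auto intro: Q)
    then show "q analytic_on {w}" by (simp add: q_def o_def)
    show "norm (q w) \<le> 1" using Q(2)[OF w(2)] by (simp add: q_def)
  qed
  \<comment> \<open>Second removal: in the coordinate w = 1/z the point at infinity becomes w =
    0.\<close>
  define k where "k = remove_sings q"
  have k_eq: "k w = q w" if "w \<in> ball 0 (1 / R) - {0}" for w
    unfolding k_def using q(1)[OF that] by (rule remove_sings_at_analytic)
  have k: "k analytic_on {w} \<and> norm (k w) \<le> 1" if "w \<in> ball 0 (1 / R)" for w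
  proof (cases "w = 0")
    case False
    with that have w: "w \<in> ball 0 (1 / R) - {0}" by auto
    have "k analytic_on {w}"
      unfolding k_def by (rule remove_sings_analytic_on[OF q(1)[OF w]])
    with q(2)[OF w] k_eq[OF w] show ?thesis by simp
  next
    case True
    have "isolated_singularity_at q 0"
      unfolding isolated_singularity_at_def
    proof (intro exI conjI)
      show "q analytic_on ball 0 (1 / R) - {0}"
        by (subst analytic_on_analytic_at) (use q(1) in blast)
    qed (use R in simp)
    moreover have "\<forall>\<^sub>F w in at 0. norm (q w) \<le> 1"
      using eventually_at_in_open[of "ball 0 (1 / R)" 0] R q(2) by (auto elim: eventually_mono)
    ultimately show ?thesis
      unfolding True k_def using remove_sings_bounded[of q 0 1] by simp
  qed
  show ?thesis
  proof (rule that)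
    show "k holomorphic_on ball 0 (1 / R)"
      using k analytic_imp_holomorphic analytic_on_analytic_at by blast
    show "norm (k w) \<le> 1" if "w \<in> ball 0 (1 / R)" for w
      using k that by simp
    show "f z = k (1 / z) * g z" if z: "norm z > R" for z
    proof (cases "g z = 0")
      \<comment> \<open>At a zero of g the domination forces f to vanish too, so no value of k
        matters.\<close>
      case True
      then show ?thesis using le[OF z] by simp
    next
      case False
      have "1 / z \<in> ball 0 (1 / R) - {0}"
        using z R by (auto simp: norm_divide divide_simps intro: order_less_trans)
      then have "k (1 / z) = f z / g z"
        using h_analytic[OF False] by (simp add: k_eq q_def Q_def) (simp add: h_def)
      with False show ?thesis by simp
    qed
  qed
qed

section \<open>The norm in terms of Taylor coefficients\<close>

text \<open>The weight is radial, so the integral may be averaged over rotations. After exchanging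
  the integrals, Parseval's identity turns the average into a series, and each term is a moment of
  the weight. All integrands are nonnegative, so the identity also covers infinite values.\<close>

lemma nn_integral_fock:
  assumes a: "\<And>z. summable (\<lambda>n. a n * z ^ n)" and \<alpha>: "\<alpha> > 0" and \<beta>: "\<beta> > -1"
  shows "(\<integral>\<^sup>+z. ennreal ((norm (power_sum a z))\<^sup>2 * fock_weight \<alpha> \<beta> z) \<partial>lborel)
    = (\<Sum>n. ennreal ((norm (a n))\<^sup>2 * (pi * Gamma (real n + (\<beta> + 1)) / \<alpha> powr (real n + (\<beta> + 1)))))"
proof -
  let ?f = "power_sum a" and ?w = "fock_weight \<alpha> \<beta>"
  define c where "c = circlepath 0 1"
  have norm_c: "norm (c t) = 1" for t by (simp add: c_def)
  have [measurable]: "?f \<in> borel_measurable borel"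
    using holomorphic_on_imp_continuous_on[OF power_sum_holomorphic[OF a]]
    by (rule borel_measurable_continuous_onI)
  have [measurable]: "c \<in> borel_measurable borel"
    unfolding c_def by (intro borel_measurable_continuous_onI continuous_intros)
  have w_c: "?w (c t * z) = ?w z" for t z
    by (simp add: fock_weight_def norm_mult norm_c)
  let ?I = "\<integral>\<^sup>+z. ennreal ((norm (?f z))\<^sup>2 * ?w z) \<partial>lborel"
  have rot: "(\<integral>\<^sup>+z. ennreal ((norm (?f (c t * z)))\<^sup>2 * ?w z) \<partial>lborel) = ?I" for t
    using nn_integral_rotate[of "\<lambda>z. ennreal ((norm (?f z))\<^sup>2 * ?w z)" "c t"] by (simp add: norm_c w_c)
  have mean: "(\<integral>\<^sup>+t. ennreal ((norm (?f (c t * z)))\<^sup>2 * ?w z) * indicator {0..1} t \<partial>lborel)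
      = (\<Sum>n. ennreal ((norm (a n))\<^sup>2) * ennreal (norm z ^ (2 * n) * ?w z))" for z
  proof -
    \<comment> \<open>As a function of the rotation, this is a power series in the point of the unit circle.\<close>
    define b where "b = (\<lambda>n. a n * z ^ n)"
    have b: "summable (\<lambda>n. b n * \<zeta> ^ n)" for \<zeta>
      using a[of "z * \<zeta>"] by (simp add: b_def power_mult_distrib mult.assoc)
    have fb: "?f (c t * z) = power_sum b (circlepath 0 1 t)" for t
      by (simp add: power_sum_def b_def c_def power_mult_distrib mult_ac)
    have cont: "continuous_on (sphere 0 1) (power_sum b)"
      using holomorphic_on_imp_continuous_on[OF power_sum_holomorphic[OF b]] continuous_on_subset by blast
    have "(\<integral>\<^sup>+t. ennreal ((norm (?f (c t * z)))\<^sup>2 * ?w z) * indicator {0..1} t \<partial>lborel)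
        = ennreal (circle_norm_sq (power_sum b) 1 * ?w z)"
      unfolding fb
      by (intro nn_integral_has_integral_lebesgue' has_integral_mult_left circle_norm_sq_has_integral cont) auto
    also have "(\<lambda>n. (norm (b n))\<^sup>2 * ?w z) sums (circle_norm_sq (power_sum b) 1 * ?w z)"
      using circle_norm_sq_power_sum[OF b, of 1] by (intro sums_mult2) simp
    then have "ennreal (circle_norm_sq (power_sum b) 1 * ?w z) = (\<Sum>n. ennreal ((norm (b n))\<^sup>2 * ?w z))"
      by (subst suminf_ennreal_eq) auto
    also have "\<dots> = (\<Sum>n. ennreal ((norm (a n))\<^sup>2) * ennreal (norm z ^ (2 * n) * ?w z))"
      by (intro suminf_cong, subst ennreal_mult' [symmetric])
        (simp_all add: b_def norm_mult norm_power power_mult_distrib power_even_eq mult.assoc)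
    finally show ?thesis .
  qed
  \<comment> \<open>A constant is averaged over [0, 1] to introduce the rotation parameter.\<close>
  have "?I = (\<integral>\<^sup>+t. ?I * indicator {0..1::real} t \<partial>lborel)"
    by (subst nn_integral_cmult_indicator) auto
  also have "\<dots> = (\<integral>\<^sup>+t. (\<integral>\<^sup>+z. ennreal ((norm (?f (c t * z)))\<^sup>2 * ?w z) * indicator {0..1} t \<partial>lborel) \<partial>lborel)"
    by (intro nn_integral_cong, subst nn_integral_multc) (auto simp: rot)
  also have "\<dots> = (\<integral>\<^sup>+z. (\<integral>\<^sup>+t. ennreal ((norm (?f (c t * z)))\<^sup>2 * ?w z) * indicator {0..1} t \<partial>lborel) \<partial>lborel)"
    by (rule lborel_pair.Fubini') measurable
  also have "\<dots> = (\<integral>\<^sup>+z. (\<Sum>n. ennreal ((norm (a n))\<^sup>2) * ennreal (norm z ^ (2 * n) * ?w z)) \<partial>lborel)"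
    by (simp only: mean)
  also have "\<dots> = (\<Sum>n. \<integral>\<^sup>+z. ennreal ((norm (a n))\<^sup>2) * ennreal (norm z ^ (2 * n) * ?w z) \<partial>lborel)"
    by (intro nn_integral_suminf) measurable
  also have "\<dots> = (\<Sum>n. ennreal ((norm (a n))\<^sup>2) * ennreal (pi * Gamma (real n + (\<beta> + 1)) / \<alpha> powr (real n + (\<beta> + 1))))"
    by (intro suminf_cong, subst nn_integral_cmult) (simp_all add: fock_moment[OF \<alpha> \<beta>])
  finally show ?thesis
    by (simp only: ennreal_mult'[OF zero_le_power2])
qed

section \<open>The Korenblum radius\<close>

text \<open>Summation by parts: the increments of c are nonnegative and multiply the nonnegative
  tail differences \<open>S\<close>.\<close>

lemma sum_le_of_tails_le:
  fixes c p q :: "nat \<Rightarrow> real"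
  assumes p: "summable p" and q: "summable q" "\<And>n. q n \<ge> 0"
    and tails: "\<And>N. (\<Sum>n. p (n + N)) \<le> (\<Sum>n. q (n + N))"
    and c: "incseq c" "\<And>n. c n \<ge> 0"
    and cp: "summable (\<lambda>n. c n * p n)" and cq: "summable (\<lambda>n. c n * q n)"
    and p0: "\<And>n. p n \<ge> 0"
  shows "(\<Sum>n. c n * p n) \<le> (\<Sum>n. c n * q n)"
proof -
  define S where "S = (\<lambda>N. (\<Sum>n. q (n + N)) - (\<Sum>n. p (n + N)))"
  have S0: "S N \<ge> 0" for N
    using tails by (simp add: S_def)
  have S_Suc: "S N = q N - p N + S (Suc N)" for N
    using suminf_split_head[of "\<lambda>n. q (n + N)"] suminf_split_head[of "\<lambda>n. p (n + N)"] p q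
    by (simp add: S_def summable_iff_shift)
  \<comment> \<open>Summation by parts up to M, with boundary term \<open>c M * S M\<close>.\<close>
  have abel: "(\<Sum>n<M. c n * q n) - (\<Sum>n<M. c n * p n) + c M * S M \<ge> 0" for M
  proof (induction M)
    case (Suc M)
    have "c M * S (Suc M) \<le> c (Suc M) * S (Suc M)"
      using c S0 by (intro mult_right_mono) (auto simp: incseq_SucD)
    moreover have "c M * S M = c M * q M - c M * p M + c M * S (Suc M)"
      by (subst S_Suc) (simp add: algebra_simps)
    ultimately show ?case
      using Suc.IH by simp
  qed (use c S0 in simp)
  \<comment> \<open>The weights may grow without bound, so the boundary term is compared with the
    tail of the convergent weighted series of q, using monotonicity of c once more.\<close>
  have rem: "c M * S M \<le> (\<Sum>n. c (n + M) * q (n + M))" for M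
  proof -
    have "S M \<le> (\<Sum>n. q (n + M))"
      unfolding S_def using p p0 by (simp add: suminf_nonneg summable_iff_shift)
    then have "c M * S M \<le> c M * (\<Sum>n. q (n + M))"
      using c by (intro mult_left_mono) auto
    also have "\<dots> = (\<Sum>n. c M * q (n + M))"
      using q by (intro suminf_mult [symmetric]) (simp add: summable_iff_shift)
    also have "\<dots> \<le> (\<Sum>n. c (n + M) * q (n + M))"
      using q c cq by (intro suminf_le mult_right_mono summable_mult incseqD[OF c(1)])
        (auto simp: summable_iff_shift[of q] summable_iff_shift[of "\<lambda>n. c n * q n"])
    finally show ?thesis .
  qed
  have "(\<lambda>M. (\<Sum>n<M. c n * q n) - (\<Sum>n<M. c n * p n) + (\<Sum>n. c (n + M) * q (n + M)))
      \<longlonglongrightarrow> (\<Sum>n. c n * q n) - (\<Sum>n. c n * p n) + 0"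
    by (intro tendsto_add tendsto_diff summable_LIMSEQ cp cq suminf_exist_split2)
  then have "(\<Sum>n. c n * q n) - (\<Sum>n. c n * p n) + 0 \<ge> 0"
  proof (rule tendsto_lowerbound)
    show "\<forall>\<^sub>F M in sequentially. 0 \<le> (\<Sum>n<M. c n * q n) - (\<Sum>n<M. c n * p n) + (\<Sum>n. c (n + M) * q (n + M))"
    proof (rule always_eventually, rule allI)
      fix M show "0 \<le> (\<Sum>n<M. c n * q n) - (\<Sum>n<M. c n * p n) + (\<Sum>n. c (n + M) * q (n + M))"
        using abel[of M] rem[of M] by linarith
    qed
  qed simp
  then show ?thesis by simp
qed

text \<open>The squared norm of the monomial z^n, as computed in \<open>fock_moment\<close>.\<close>

definition fock_coeff :: "real \<Rightarrow> real \<Rightarrow> nat \<Rightarrow> real" where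
  "fock_coeff \<alpha> \<beta> n = pi * Gamma (real n + (\<beta> + 1)) / \<alpha> powr (real n + (\<beta> + 1))"

lemma fock_coeff_pos: "\<alpha> > 0 \<Longrightarrow> \<beta> > -1 \<Longrightarrow> fock_coeff \<alpha> \<beta> n > 0"
  unfolding fock_coeff_def by (intro divide_pos_pos mult_pos_pos Gamma_real_pos) auto

lemma fock_coeff_Suc:
  assumes "\<alpha> > 0" "\<beta> > -1"
  shows "fock_coeff \<alpha> \<beta> (Suc n) = (real n + (\<beta> + 1)) / \<alpha> * fock_coeff \<alpha> \<beta> n"
proof -
  define s where "s = real n + (\<beta> + 1)"
  have s: "s > 0" "real (Suc n) + (\<beta> + 1) = s + 1" using assms by (auto simp: s_def)
  then have "s \<notin> \<int>\<^sub>\<le>\<^sub>0" by (auto elim!: nonpos_Ints_cases')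
  then show ?thesis
    unfolding fock_coeff_def s(2) s_def[symmetric] using assms(1)
    by (simp add: Gamma_plus1 powr_add mult_ac)
qed

text \<open>The integral and the series agree as extended nonnegative numbers, so one is finite
  exactly when the other is.\<close>

lemma fock_space_summable:
  assumes a: "\<And>z. summable (\<lambda>n. a n * z ^ n)" and \<alpha>: "\<alpha> > 0" and \<beta>: "\<beta> > -1"
  shows "power_sum a \<in> fock_space \<alpha> \<beta> \<longleftrightarrow> summable (\<lambda>n. fock_coeff \<alpha> \<beta> n * (norm (a n))\<^sup>2)"
    and "power_sum a \<in> fock_space \<alpha> \<beta> \<Longrightarrow>
      fock_norm \<alpha> \<beta> (power_sum a) = sqrt (\<Sum>n. fock_coeff \<alpha> \<beta> n * (norm (a n))\<^sup>2)"
proof -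
  let ?u = "\<lambda>z. (norm (power_sum a z))\<^sup>2 * fock_weight \<alpha> \<beta> z"
  let ?s = "\<lambda>n. fock_coeff \<alpha> \<beta> n * (norm (a n))\<^sup>2"
  have hol: "power_sum a holomorphic_on UNIV"
    by (rule power_sum_holomorphic[OF a])
  have [measurable]: "power_sum a \<in> borel_measurable borel"
    using holomorphic_on_imp_continuous_on[OF hol] by (rule borel_measurable_continuous_onI)
  have s0: "?s n \<ge> 0" for n
    using fock_coeff_pos[OF \<alpha> \<beta>, of n] by simp
  have I: "(\<integral>\<^sup>+z. ennreal (?u z) \<partial>lborel) = (\<Sum>n. ennreal (?s n))"
    unfolding nn_integral_fock[OF a \<alpha> \<beta>] fock_coeff_def
    by (intro suminf_cong arg_cong[where f = ennreal] mult.commute)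
  have "integrable lborel ?u \<longleftrightarrow> (\<Sum>n. ennreal (?s n)) \<noteq> top"
  proof -
    have "norm (?u z) = ?u z" for z
      unfolding real_norm_def by (rule abs_of_nonneg) (intro mult_nonneg_nonneg zero_le_power2 fock_weight_nonneg)
    moreover have "?u \<in> borel_measurable lborel"
      by measurable
    ultimately have "integrable lborel ?u \<longleftrightarrow> (\<integral>\<^sup>+z. ennreal (?u z) \<partial>lborel) < \<infinity>"
      unfolding integrable_iff_bounded by (simp only: simp_thms)
    then show ?thesis
      unfolding I by (simp only: infinity_ennreal_def less_top)
  qed
  moreover have "(\<Sum>n. ennreal (?s n)) \<noteq> top \<longleftrightarrow> summable ?s"
  proof
    assume "(\<Sum>n. ennreal (?s n)) \<noteq> top"
    then show "summable ?s" by (rule summable_suminf_not_top[OF s0])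
  next
    assume "summable ?s"
    then show "(\<Sum>n. ennreal (?s n)) \<noteq> top" by (rule ennreal_suminf_neq_top[OF _ s0])
  qed
  ultimately show iff: "power_sum a \<in> fock_space \<alpha> \<beta> \<longleftrightarrow> summable ?s"
    by (simp only: fock_space_def mem_Collect_eq hol simp_thms)
  assume "power_sum a \<in> fock_space \<alpha> \<beta>"
  then have sm: "summable ?s"
    by (simp only: iff)
  then have "(\<integral>\<^sup>+z. ennreal (?u z) \<partial>lborel) = ennreal (\<Sum>n. ?s n)"
    unfolding I by (rule suminf_ennreal2[OF s0])
  moreover have "integral\<^sup>L lborel ?u = enn2real (\<integral>\<^sup>+z. ennreal (?u z) \<partial>lborel)"
    by (rule integral_eq_nn_integral) simp_all
  ultimately show "fock_norm \<alpha> \<beta> (power_sum a) = sqrt (\<Sum>n. ?s n)"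
    unfolding fock_norm_def using suminf_nonneg[OF sm s0] by (simp only: enn2real_ennreal)
qed

theorem admissible_sqrt:
  assumes \<alpha>: "\<alpha> > 0" and \<beta>: "\<beta> > -1"
  shows "admissible \<alpha> \<beta> (sqrt ((\<beta> + 1) / \<alpha>))"
  unfolding admissible_def
proof (intro conjI ballI impI)
  define R where "R = sqrt ((\<beta> + 1) / \<alpha>)"
  have R: "R > 0" "R\<^sup>2 = (\<beta> + 1) / \<alpha>"
    using \<alpha> \<beta> by (auto simp: R_def)
  then show "sqrt ((\<beta> + 1) / \<alpha>) > 0" by (simp add: R_def)
  fix f g
  assume f: "f \<in> fock_space \<alpha> \<beta>" and g: "g \<in> fock_space \<alpha> \<beta>"
    and le: "\<forall>z. norm z > sqrt ((\<beta> + 1) / \<alpha>) \<longrightarrow> norm (f z) \<le> norm (g z)"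
  have hol: "f holomorphic_on UNIV" "g holomorphic_on UNIV"
    using f g by (auto simp: fock_space_def)
  obtain a where a: "\<And>z. summable (\<lambda>n. a n * z ^ n)" "f = power_sum a"
    using entire_eq_power_sum[OF hol(1)] by blast
  obtain b where b: "\<And>z. summable (\<lambda>n. b n * z ^ n)" "g = power_sum b"
    using entire_eq_power_sum[OF hol(2)] by blast
  have le_R: "norm (f z) \<le> norm (g z)" if "norm z > R" for z
    using le that by (simp add: R_def)
  obtain k where k: "k holomorphic_on ball 0 (1 / R)" "\<And>w. w \<in> ball 0 (1 / R) \<Longrightarrow> norm (k w) \<le> 1"
    "\<And>z. norm z > R \<Longrightarrow> f z = k (1 / z) * g z"
  proof (cases "\<exists>\<beta>. g \<beta> \<noteq> 0")
    case True
    then obtain \<zeta> where "g \<zeta> \<noteq> 0" by blast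
    from exterior_quotient[OF hol this R(1) le_R] that show ?thesis by blast
  next
    \<comment> \<open>If g vanishes identically, then f vanishes outside the disc and k = 0 serves
      as the quotient.\<close>
    case False
    with le_R have "f z = 0 * g z" if "norm z > R" for z
      using that by fastforce
    then show ?thesis
      using that[of "\<lambda>_. 0"] by auto
  qed
  \<comment> \<open>The factor R^(2n) is moved from the norm coefficients to the squared Taylor
    coefficients, to match the tails compared in \<open>coeff_tail_le\<close>.\<close>
  define c where "c = (\<lambda>n. fock_coeff \<alpha> \<beta> n / R ^ (2 * n))"
  define p where "p = (\<lambda>n. (norm (a n))\<^sup>2 * R ^ (2 * n))"
  define q where "q = (\<lambda>n. (norm (b n))\<^sup>2 * R ^ (2 * n))"
  have cp: "c n * p n = fock_coeff \<alpha> \<beta> n * (norm (a n))\<^sup>2"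
    and cq: "c n * q n = fock_coeff \<alpha> \<beta> n * (norm (b n))\<^sup>2" for n
    using R(1) by (auto simp: c_def p_def q_def)
  have c_pos: "c n > 0" for n
    using fock_coeff_pos[OF \<alpha> \<beta>, of n] R(1) by (simp add: c_def)
  have "c n \<le> c (Suc n)" for n
  proof -
    have "c (Suc n) = (real n + (\<beta> + 1)) / \<alpha> / R\<^sup>2 * c n"
      by (simp add: c_def fock_coeff_Suc[OF \<alpha> \<beta>] power2_eq_square)
    \<comment> \<open>The ratio equals 1 at n = 0: this R is the largest radius for which the
      weights c are nondecreasing.\<close>
    also have "(real n + (\<beta> + 1)) / \<alpha> / R\<^sup>2 = real n / (\<beta> + 1) + 1"
      using \<alpha> \<beta> by (simp add: R(2) divide_simps)
    also have "(real n / (\<beta> + 1) + 1) * c n \<ge> 1 * c n"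
      using c_pos[of n] \<beta> by (intro mult_right_mono) auto
    finally show ?thesis by simp
  qed
  then have c_inc: "incseq c" by (rule incseq_SucI)
  have "(\<Sum>n. c n * p n) \<le> (\<Sum>n. c n * q n)"
  proof (rule sum_le_of_tails_le)
    show "summable p" "summable q"
      unfolding p_def q_def
      using circle_norm_sq_power_sum[OF a(1) R(1)] circle_norm_sq_power_sum[OF b(1) R(1)]
      by (auto dest: sums_summable)
    show "summable (\<lambda>n. c n * p n)" "summable (\<lambda>n. c n * q n)"
      unfolding cp cq using f g fock_space_summable(1)[OF a(1) \<alpha> \<beta>] fock_space_summable(1)[OF b(1) \<alpha> \<beta>] a(2) b(2)
      by auto
    show "(\<Sum>n. p (n + N)) \<le> (\<Sum>n. q (n + N))" for N
    proof -
      have sm: "summable (\<lambda>n. (norm (d (n + N)))\<^sup>2 * R ^ (2 * n))"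
        if "\<And>z. summable (\<lambda>n. d n * z ^ n)" for d :: "nat \<Rightarrow> complex"
        using circle_norm_sq_power_sum[OF summable_powser_shift[OF that] R(1)] by (auto dest: sums_summable)
      have "(\<Sum>n. (norm (a (n + N)))\<^sup>2 * R ^ (2 * n)) \<le> (\<Sum>n. (norm (b (n + N)))\<^sup>2 * R ^ (2 * n))"
        using k a(2) b(2) by (intro coeff_tail_le[OF a(1) b(1) k(1) k(2) _ R(1)]) auto
      \<comment> \<open>\<open>coeff_tail_le\<close> weights the shifted coefficients by R^(2n); the
        tails of p and q carry R^(2(n + N)).\<close>
      then have "R ^ (2 * N) * (\<Sum>n. (norm (a (n + N)))\<^sup>2 * R ^ (2 * n))
          \<le> R ^ (2 * N) * (\<Sum>n. (norm (b (n + N)))\<^sup>2 * R ^ (2 * n))"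
        using R(1) by (intro mult_left_mono) auto
      moreover have "(\<Sum>n. (norm (d (n + N)))\<^sup>2 * R ^ (2 * (n + N)))
          = R ^ (2 * N) * (\<Sum>n. (norm (d (n + N)))\<^sup>2 * R ^ (2 * n))"
        if "\<And>z. summable (\<lambda>n. d n * z ^ n)" for d :: "nat \<Rightarrow> complex"
        unfolding suminf_mult [OF sm[OF that], symmetric]
        by (simp add: distrib_left power_add mult_ac)
      ultimately show ?thesis
        unfolding p_def q_def using a(1) b(1) by simp
    qed
    show "c n \<ge> 0" for n
      using c_pos[of n] by simp
  qed (auto simp: p_def q_def c_inc R(1) less_imp_le)
  then show "fock_norm \<alpha> \<beta> f \<le> fock_norm \<alpha> \<beta> g"
    using fock_space_summable(2)[OF a(1) \<alpha> \<beta>] fock_space_summable(2)[OF b(1) \<alpha> \<beta>] f g a(2) b(2)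
    by (simp add: cp cq)
qed

section \<open>Sharpness, tested on monomials\<close>

lemma fock_monomial:
  assumes "\<alpha> > 0" "\<beta> > -1"
  shows "(\<lambda>z. C * z ^ m) \<in> fock_space \<alpha> \<beta>"
    and "fock_norm \<alpha> \<beta> (\<lambda>z. C * z ^ m) = sqrt (fock_coeff \<alpha> \<beta> m * (norm C)\<^sup>2)"
proof -
  define a where "a = (\<lambda>n. if n = m then C else 0)"
  have sums: "(\<lambda>n. a n * z ^ n) sums (C * z ^ m)" for z
    using sums_single[of m "\<lambda>n. C * z ^ n"] by (simp add: a_def if_distrib[of "\<lambda>x. x * _"] cong: if_cong)
  then have sm: "summable (\<lambda>n. a n * z ^ n)" for z
    by (rule sums_summable)
  have eq: "power_sum a = (\<lambda>z. C * z ^ m)"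
    using sums by (auto simp: power_sum_def sums_iff)
  have s: "(\<lambda>n. fock_coeff \<alpha> \<beta> n * (norm (a n))\<^sup>2) sums (fock_coeff \<alpha> \<beta> m * (norm C)\<^sup>2)"
    using sums_single[of m "\<lambda>n. fock_coeff \<alpha> \<beta> n * (norm C)\<^sup>2"]
    by (simp add: a_def if_distrib[of "\<lambda>x. _ * (norm x)\<^sup>2"] cong: if_cong)
  show "(\<lambda>z. C * z ^ m) \<in> fock_space \<alpha> \<beta>"
    using fock_space_summable(1)[OF sm assms] s by (auto simp: eq dest: sums_summable)
  then show "fock_norm \<alpha> \<beta> (\<lambda>z. C * z ^ m) = sqrt (fock_coeff \<alpha> \<beta> m * (norm C)\<^sup>2)"
    using fock_space_summable(2)[OF sm assms] s by (auto simp: eq sums_iff)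
qed

lemma admissible_le:
  assumes \<alpha>: "\<alpha> > 0" and \<beta>: "\<beta> > -1" and adm: "admissible \<alpha> \<beta> R"
  shows "R \<le> sqrt ((\<beta> + 1) / \<alpha>)"
proof -
  have R: "R > 0" using adm by (simp add: admissible_def)
  \<comment> \<open>The constant R and the function z have equal modulus on |z| = R; both are
    written as monomials to fit \<open>fock_monomial\<close>.\<close>
  have "fock_norm \<alpha> \<beta> (\<lambda>z. of_real R * z ^ 0) \<le> fock_norm \<alpha> \<beta> (\<lambda>z. 1 * z ^ 1)"
  proof -
    have le: "fock_norm \<alpha> \<beta> f \<le> fock_norm \<alpha> \<beta> g"
      if "f \<in> fock_space \<alpha> \<beta>" "g \<in> fock_space \<alpha> \<beta>" "\<And>z. norm z > R \<Longrightarrow> norm (f z) \<le> norm (g z)" for f g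
      using adm that unfolding admissible_def by blast
    show ?thesis
      by (rule le[OF fock_monomial(1)[OF \<alpha> \<beta>] fock_monomial(1)[OF \<alpha> \<beta>]]) (use R in simp)
  qed
  \<comment> \<open>By the recurrence at n = 0, the squared norm of z is (\<beta> + 1) / \<alpha>
    times that of 1.\<close>
  then have "fock_coeff \<alpha> \<beta> 0 * R\<^sup>2 \<le> fock_coeff \<alpha> \<beta> 0 * ((\<beta> + 1) / \<alpha>)"
    using fock_coeff_Suc[OF \<alpha> \<beta>, of 0] unfolding fock_monomial(2)[OF \<alpha> \<beta>] by (simp add: mult.commute)
  then have "R\<^sup>2 \<le> (\<beta> + 1) / \<alpha>"
    using fock_coeff_pos[OF \<alpha> \<beta>, of 0] by (simp only: mult_le_cancel_left_pos)
  then show ?thesis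
    by (rule real_le_rsqrt)
qed

theorem korenblum_radius_eq:
  assumes "\<alpha> > 0" "\<beta> > -1"
  shows "korenblum_radius \<alpha> \<beta> = ereal (sqrt ((\<beta> + 1) / \<alpha>))"
  unfolding korenblum_radius_def
proof (rule antisym)
  show "(SUP R\<in>{R. admissible \<alpha> \<beta> R}. ereal R) \<le> ereal (sqrt ((\<beta> + 1) / \<alpha>))"
    using admissible_le[OF assms] by (intro SUP_least) simp
  show "ereal (sqrt ((\<beta> + 1) / \<alpha>)) \<le> (SUP R\<in>{R. admissible \<alpha> \<beta> R}. ereal R)"
    using admissible_sqrt[OF assms] by (intro SUP_upper) simp
qed

theorem corollary1p4:
  fixes \<alpha> :: real
  assumes "\<alpha> > 0"
  shows "(\<exists>!\<kappa>. \<kappa> > 0 \<and> kappa_eq \<kappa>)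
    \<and> 5.4475 \<le> kappa1 - 1 \<and> kappa1 - 1 < 5.4476
    \<and> (\<forall>\<beta>. -1 < \<beta> \<and> \<beta> \<le> kappa1 - 1 \<longrightarrow>
          korenblum_radius \<alpha> \<beta> = ereal (sqrt ((\<beta> + 1) / \<alpha>))
          \<and> admissible \<alpha> \<beta> (sqrt ((\<beta> + 1) / \<alpha>)))
    \<and> kappa1 > 2 * pi
    \<and> (\<forall>\<beta>. -1 < \<beta> \<and> \<beta> \<le> 2 * pi - 1 \<longrightarrow>
          korenblum_radius \<alpha> \<beta> = ereal (sqrt ((\<beta> + 1) / \<alpha>))
          \<and> admissible \<alpha> \<beta> (sqrt ((\<beta> + 1) / \<alpha>)))"
proof -
  have "2 * pi < kappa1"
    using kappa1_properties(2) pi_approx by simp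
  then show ?thesis
    using kappa1_properties korenblum_radius_eq[OF assms] admissible_sqrt[OF assms] by auto
qed

end
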